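(* Let $R$ be a ring of characteristic $0$ and let $a,b\in R$ be such that $a^2=b^2=0$. Then $(1+a,1+b)$ is a free pair if and only if one of the following conditions holds: (1) $ab$ is transcendental over $\mathbb{Q}$. (2) $ab$ is algebraic over $\mathbb{Q}$ and one of the eigenvalues of $ab$ is free.
   Context: Rings are associative with identity. A pair $(g,h)$ of elements of a group is a free pair if $\langle g,h\rangle$ is a non-abelian free group (free on the two generators $g,h$); here the group is the group of units of $R$ (note $(1+a)(1-a)=1$). A complex number $z$ is free if the matrices $\begin{pmatrix}1&1\\ 0&1\end{pmatrix}$ and $\begin{pmatrix}1&0\\ z&1\end{pmatrix}$ form a free pair; otherwise $z$ is non-free. Convention: a ring $R$ of characteristic $0$ is regarded as embedded in the complex algebra $R\otimes_{\mathbb{Z}}\mathbb{C}$ via $r\mapsto r\otimes 1$ (i.e. $R$ is torsion-free as an abelian group). An element of $R$ is algebraic over $\mathbb{Q}$ if, in this algebra, it is a root of a nonzero polynomial in one variable with rational coefficients, and transcendental over $\mathbb{Q}$ otherwise. The eigenvalues of $x\in R$ are the (complex) eigenvalues of the left multiplication by $x$ on this complex algebra; for an algebraic element these are the roots of its minimal polynomial. *)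

theory Defs
  imports
    "HOL-Analysis.Analysis"
    "HOL-Algebra.Generated_Groups"
    "HOL-Library.Multiset"
    "HOL-Computational_Algebra.Polynomial"
begin

section \<open>Free groups and free pairs\<close>

text \<open>A letter \<open>(s, True)\<close> stands for the generator \<open>s\<close>, and \<open>(s, False)\<close> for its inverse.\<close>

type_synonym 's letter = "'s \<times> bool"

definition inv_letter :: "'s letter \<Rightarrow> 's letter" where
  "inv_letter x = (fst x, \<not> snd x)"

definition reduced :: "'s letter list \<Rightarrow> bool" where
  "reduced w \<longleftrightarrow> successively (\<lambda>x y. y \<noteq> inv_letter x) w"

fun push_letter :: "'s letter \<Rightarrow> 's letter list \<Rightarrow> 's letter list" where
  "push_letter x [] = [x]"
| "push_letter x (y # w) = (if y = inv_letter x then w else x # y # w)"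

text \<open>Pushing the letters of \<open>u\<close> one by one onto a reduced word \<open>v\<close> yields the reduced form of \<open>u @ v\<close>.\<close>

definition free_group :: "'s set \<Rightarrow> 's letter list monoid" where
  "free_group S =
     \<lparr>carrier = {w. set w \<subseteq> S \<times> UNIV \<and> reduced w},
      Group.monoid.mult = (\<lambda>u v. foldr push_letter u v),
      one = []\<rparr>"

lemma inv_letter_inv_letter [simp]: "inv_letter (inv_letter x) = x"
  by (simp add: inv_letter_def)

lemma inv_letter_neq [simp]: "inv_letter x \<noteq> x" "x \<noteq> inv_letter x"
  by (simp_all add: inv_letter_def prod_eq_iff)

lemma reduced_Nil [simp]: "reduced []"
  by (simp add: reduced_def)

lemma reduced_tl: "reduced (x # w) \<Longrightarrow> reduced w"
  by (cases w) (auto simp: reduced_def)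

lemma reduced_push: "reduced w \<Longrightarrow> reduced (push_letter x w)"
  by (cases w) (auto simp: reduced_def dest: reduced_tl[unfolded reduced_def])

lemma reduced_foldr_push: "reduced v \<Longrightarrow> reduced (foldr push_letter u v)"
  by (induction u) (auto intro: reduced_push)

lemma push_inv_push:
  assumes "reduced w"
  shows "push_letter x (push_letter (inv_letter x) w) = w"
proof (cases w)
  case (Cons y ys)
  then show ?thesis
    using assms by (cases ys) (auto simp: reduced_def)
qed simp

lemma set_push: "set (push_letter x w) \<subseteq> insert x (set w)"
  by (cases w) auto

lemma set_foldr_push: "set (foldr push_letter u v) \<subseteq> set u \<union> set v"
proof (induction u)
  case (Cons x u)
  then show ?case
    using set_push[of x "foldr push_letter u v"] by auto
qed simp

lemma foldr_push_push:
  assumes "reduced w"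
  shows "foldr push_letter (push_letter x v) w = push_letter x (foldr push_letter v w)"
proof (cases v)
  case (Cons y ys)
  show ?thesis
    using push_inv_push[OF reduced_foldr_push[OF assms], of x ys] Cons by auto
qed simp

lemma foldr_push_assoc:
  assumes "reduced w"
  shows "foldr push_letter (foldr push_letter u v) w
         = foldr push_letter u (foldr push_letter v w)"
  by (induction u) (simp_all add: foldr_push_push assms)

lemma foldr_push_Nil: "reduced u \<Longrightarrow> foldr push_letter u [] = u"
proof (induction u)
  case (Cons x u)
  then show ?case
    using reduced_tl[OF Cons.prems] by (cases u) (auto simp: reduced_def)
qed simp

lemma foldr_push_inverse:
  assumes "reduced w"
  shows "foldr push_letter (map inv_letter (rev u)) (foldr push_letter u w) = w"
  using assms
proof (induction u arbitrary: w)
  case (Cons x u)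
  have "push_letter (inv_letter x) (push_letter x (foldr push_letter u w))
        = foldr push_letter u w"
    using push_inv_push[OF reduced_foldr_push[OF Cons.prems], of "inv_letter x" u] by simp
  then show ?case
    using Cons by simp
qed simp

lemma group_free_group: "group (free_group S)"
proof (rule groupI)
  fix u assume u: "u \<in> carrier (free_group S)"
  define v where "v = foldr push_letter (map inv_letter (rev u)) []"
  have "set v \<subseteq> S \<times> UNIV"
    using set_foldr_push[of "map inv_letter (rev u)" "[]"] u
    by (fastforce simp: v_def free_group_def inv_letter_def)
  moreover have "reduced v"
    by (simp add: v_def reduced_foldr_push)
  moreover have "foldr push_letter v u = []"
    using u foldr_push_assoc[of u "map inv_letter (rev u)" "[]"] foldr_push_inverse[of "[]" u]
      foldr_push_Nil[of u]
    by (simp add: v_def free_group_def)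
  ultimately show "\<exists>v\<in>carrier (free_group S). v \<otimes>\<^bsub>free_group S\<^esub> u = \<one>\<^bsub>free_group S\<^esub>"
    by (auto simp: free_group_def)
next
  fix u v assume "u \<in> carrier (free_group S)" "v \<in> carrier (free_group S)"
  then show "u \<otimes>\<^bsub>free_group S\<^esub> v \<in> carrier (free_group S)"
    using set_foldr_push[of u v] by (auto simp: free_group_def reduced_foldr_push)
qed (auto simp: free_group_def foldr_push_assoc)

definition free_with_basis :: "('s, 'm) monoid_scheme \<Rightarrow> 's set \<Rightarrow> bool" where
  "free_with_basis G S \<longleftrightarrow> (\<exists>\<phi> \<in> iso (free_group S) G. \<forall>s\<in>S. \<phi> [(s, True)] = s)"

definition free_pair :: "('g, 'm) monoid_scheme \<Rightarrow> 'g \<Rightarrow> 'g \<Rightarrow> bool" where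
  "free_pair G g h \<longleftrightarrow>
     g \<in> carrier G \<and> h \<in> carrier G \<and> g \<noteq> h \<and>
     free_with_basis (subgroup_generated G {g, h}) {g, h}"

definition unit_group :: "'a::ring_1 monoid" where
  "unit_group = units_of \<lparr>carrier = UNIV, Group.monoid.mult = (*), one = 1\<rparr>"

text \<open>The type \<open>complex^2^2\<close> carries the componentwise product as \<open>(*)\<close>, so the
  general linear group has to be formed with \<open>(**)\<close>.\<close>

definition GL2_complex :: "(complex^2^2) monoid" where
  "GL2_complex = units_of \<lparr>carrier = UNIV, Group.monoid.mult = (**), one = mat 1\<rparr>"

definition free_complex :: "complex \<Rightarrow> bool" where
  "free_complex z \<longleftrightarrow>
     free_pair GL2_complex
       (vector [vector [1, 1], vector [0, 1]])
       (vector [vector [1, 0], vector [z, 1]])"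


section \<open>The complex algebra \<open>R \<otimes>\<^sub>\<int> \<complex>\<close>\<close>

text \<open>A multiset of pairs \<open>(r, z)\<close> is a formal sum of symbols \<open>r \<otimes> z\<close>. Formal differences are
  not needed, since \<open>(- r) \<otimes> z\<close> is the negative of \<open>r \<otimes> z\<close>, and so the quotient by the
  least congruence making the symbol biadditive is the tensor product over the integers
  (see \<open>tensor_universal\<close>).\<close>

inductive tensor_eq :: "('a::ring_1 \<times> complex) multiset \<Rightarrow> ('a \<times> complex) multiset \<Rightarrow> bool" where
  te_refl: "tensor_eq M M"
| te_sym: "tensor_eq M N \<Longrightarrow> tensor_eq N M"
| te_trans: "tensor_eq M N \<Longrightarrow> tensor_eq N P \<Longrightarrow> tensor_eq M P"
| te_add: "tensor_eq M M' \<Longrightarrow> tensor_eq N N' \<Longrightarrow> tensor_eq (M + N) (M' + N')"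
| te_left: "tensor_eq {#(r + s, z)#} ({#(r, z)#} + {#(s, z)#})"
| te_right: "tensor_eq {#(r, z + w)#} ({#(r, z)#} + {#(r, w)#})"
| te_zero: "tensor_eq {#(0, z)#} {#}"

lemma equivp_tensor_eq: "equivp tensor_eq"
  by (rule equivpI)
    (auto simp: reflp_def symp_def transp_def intro: te_refl te_sym te_trans)

quotient_type (overloaded) 'a complex_tensor = "('a::ring_1 \<times> complex) multiset" / tensor_eq
  by (rule equivp_tensor_eq)

definition formal_mult ::
  "('a::ring_1 \<times> complex) multiset \<Rightarrow> ('a \<times> complex) multiset \<Rightarrow> ('a \<times> complex) multiset" where
  "formal_mult M N = (\<Sum>p\<in>#M. image_mset (\<lambda>q. (fst p * fst q, snd p * snd q)) N)"

definition formal_neg :: "('a::ring_1 \<times> complex) multiset \<Rightarrow> ('a \<times> complex) multiset" where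
  "formal_neg M = image_mset (\<lambda>p. (- fst p, snd p)) M"

lemma formal_mult_empty [simp]: "formal_mult {#} N = {#}" "formal_mult M {#} = {#}"
  by (induction M) (auto simp: formal_mult_def)

lemma formal_mult_single [simp]: "formal_mult {#(r, z)#} {#(s, w)#} = {#(r * s, z * w)#}"
  by (simp add: formal_mult_def)

lemma formal_mult_add_left: "formal_mult (M + M') N = formal_mult M N + formal_mult M' N"
  by (simp add: formal_mult_def)

lemma formal_mult_add_right: "formal_mult M (N + N') = formal_mult M N + formal_mult M N'"
  by (induction M) (auto simp: formal_mult_def)

lemma formal_mult_assoc: "formal_mult (formal_mult M N) P = formal_mult M (formal_mult N P)"
proof (induction M)
  case (add p M)
  have *: "formal_mult (formal_mult {#p#} N) P = formal_mult {#p#} (formal_mult N P)"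
  proof (induction N)
    case (add q N)
    have "formal_mult (formal_mult {#p#} {#q#}) P = formal_mult {#p#} (formal_mult {#q#} P)"
      by (auto simp: formal_mult_def mult.assoc multiset.map_comp comp_def)
    then show ?case
      using add formal_mult_add_right[of "{#p#}" "{#q#}" N] formal_mult_add_left[of "{#q#}" N P]
      by (simp add: formal_mult_add_left formal_mult_add_right)
  qed simp
  show ?case
    using add * formal_mult_add_left[of "{#p#}" M] by (simp add: formal_mult_add_left)
qed simp

lemma formal_mult_one: "formal_mult {#(1, 1)#} M = M" "formal_mult M {#(1, 1)#} = M"
proof -
  show "formal_mult {#(1, 1)#} M = M"
    by (simp add: formal_mult_def)
  show "formal_mult M {#(1, 1)#} = M"
    by (induction M) (auto simp: formal_mult_def)
qed

lemma tensor_eq_formal_mult_right: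
  assumes "tensor_eq M M'"
  shows "tensor_eq (formal_mult M N) (formal_mult M' N)"
proof (induction N)
  case (add q N)
  obtain s w where q: "q = (s, w)"
    by (cases q)
  have "tensor_eq (formal_mult M {#q#}) (formal_mult M' {#q#})"
    using assms
  proof induction
    case (te_left r s' z)
    show ?case
      using tensor_eq.te_left[of "r * s" "s' * s" "z * w"]
      by (simp add: formal_mult_def q distrib_right add_mset_commute)
  next
    case (te_right r z z')
    show ?case
      using tensor_eq.te_right[of "r * s" "z * w" "z' * w"]
      by (simp add: formal_mult_def q distrib_right add_mset_commute)
  next
    case (te_zero z)
    show ?case
      using tensor_eq.te_zero[of "z * w"] by (simp add: formal_mult_def q)
  qed (auto simp: formal_mult_add_left intro: tensor_eq.intros)
  then show ?case
    using te_add[OF _ add.IH] formal_mult_add_right[of _ "{#q#}" N] by simp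
qed (simp add: te_refl)

lemma tensor_eq_formal_mult_left:
  assumes "tensor_eq N N'"
  shows "tensor_eq (formal_mult M N) (formal_mult M N')"
proof (induction M)
  case (add q M)
  obtain s w where q: "q = (s, w)"
    by (cases q)
  have "tensor_eq (formal_mult {#q#} N) (formal_mult {#q#} N')"
    using assms
  proof induction
    case (te_left r s' z)
    show ?case
      using tensor_eq.te_left[of "s * r" "s * s'" "w * z"]
      by (simp add: formal_mult_def q distrib_left add_mset_commute)
  next
    case (te_right r z z')
    show ?case
      using tensor_eq.te_right[of "s * r" "w * z" "w * z'"]
      by (simp add: formal_mult_def q distrib_left add_mset_commute)
  next
    case (te_zero z)
    show ?case
      using tensor_eq.te_zero[of "w * z"] by (simp add: formal_mult_def q)
  qed (auto simp: formal_mult_add_right intro: tensor_eq.intros)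
  then show ?case
    using te_add[OF _ add.IH] formal_mult_add_left[of "{#q#}" M] by simp
qed (simp add: te_refl)

lemma tensor_eq_formal_neg:
  "tensor_eq M N \<Longrightarrow> tensor_eq (formal_neg M) (formal_neg N)"
proof (induction rule: tensor_eq.induct)
  case (te_left r s z)
  show ?case
    using tensor_eq.te_left[of "- r" "- s" z] by (simp add: formal_neg_def)
next
  case (te_right r z w)
  show ?case
    using tensor_eq.te_right[of "- r" z w] by (simp add: formal_neg_def)
next
  case (te_zero z)
  show ?case
    using tensor_eq.te_zero[of z] by (simp add: formal_neg_def)
qed (auto simp: formal_neg_def intro: tensor_eq.intros)

lemma tensor_eq_neg_add: "tensor_eq (formal_neg M + M) {#}"
proof (induction M)
  case (add p M)
  obtain r z where p: "p = (r, z)"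
    by (cases p)
  have "tensor_eq ({#(- r, z)#} + {#(r, z)#}) {#}"
    using te_trans[OF te_sym[OF te_left[of "- r" r z]]] te_zero[of z] by simp
  from te_add[OF this add.IH] show ?case
    by (simp add: p formal_neg_def ac_simps)
qed (simp add: formal_neg_def te_refl)

instantiation complex_tensor :: (ring_1) ring
begin

lift_definition zero_complex_tensor :: "'a complex_tensor" is "{#}" .

lift_definition plus_complex_tensor ::
  "'a complex_tensor \<Rightarrow> 'a complex_tensor \<Rightarrow> 'a complex_tensor" is "(+)"
  by (rule te_add)

lift_definition uminus_complex_tensor :: "'a complex_tensor \<Rightarrow> 'a complex_tensor" is formal_neg
  by (rule tensor_eq_formal_neg)

definition minus_complex_tensor ::
  "'a complex_tensor \<Rightarrow> 'a complex_tensor \<Rightarrow> 'a complex_tensor" where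
  "minus_complex_tensor s t = s + (- t)"

lift_definition times_complex_tensor ::
  "'a complex_tensor \<Rightarrow> 'a complex_tensor \<Rightarrow> 'a complex_tensor" is formal_mult
  by (blast intro: te_trans tensor_eq_formal_mult_left tensor_eq_formal_mult_right)

instance
proof
  fix s t u :: "'a complex_tensor"
  show "s + t + u = s + (t + u)"
    by transfer (simp add: add.assoc te_refl)
  show "s + t = t + s"
    by transfer (simp add: add.commute te_refl)
  show "0 + s = s"
    by transfer (simp add: te_refl)
  show "- s + s = 0"
    by transfer (rule tensor_eq_neg_add)
  show "s - t = s + - t"
    by (simp add: minus_complex_tensor_def)
  show "s * t * u = s * (t * u)"
    by transfer (simp add: formal_mult_assoc te_refl)
  show "(s + t) * u = s * u + t * u"
    by transfer (simp add: formal_mult_add_left te_refl)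
  show "s * (t + u) = s * t + s * u"
    by transfer (simp add: formal_mult_add_right te_refl)
qed

end

text \<open>There is no \<open>ring_1\<close> instance: the tensor product is the zero ring when
  \<open>R\<close> has positive characteristic.\<close>

instantiation complex_tensor :: (ring_1) monoid_mult
begin

lift_definition one_complex_tensor :: "'a complex_tensor" is "{#(1, 1)#}" .

instance
proof
  fix s :: "'a complex_tensor"
  show "1 * s = s"
    by transfer (simp add: formal_mult_one te_refl)
  show "s * 1 = s"
    by transfer (simp add: formal_mult_one te_refl)
qed

end

lift_definition pure_tensor :: "'a::ring_1 \<Rightarrow> complex \<Rightarrow> 'a complex_tensor"
  is "\<lambda>r z. {#(r, z)#}" .

lemma pure_tensor_add_left: "pure_tensor (r + s) z = pure_tensor r z + pure_tensor s z"
  by transfer (rule te_left)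

lemma pure_tensor_add_right: "pure_tensor r (z + w) = pure_tensor r z + pure_tensor r w"
  by transfer (rule te_right)

lemma pure_tensor_mult: "pure_tensor r z * pure_tensor s w = pure_tensor (r * s) (z * w)"
  by transfer (simp add: te_refl)

lemma pure_tensor_one: "pure_tensor 1 1 = 1"
  by transfer (rule te_refl)

lemma tensor_universal:
  fixes f :: "'a::ring_1 \<Rightarrow> complex \<Rightarrow> 'b::ab_group_add"
  assumes left: "\<And>r s z. f (r + s) z = f r z + f s z"
    and right: "\<And>r z w. f r (z + w) = f r z + f r w"
  shows "\<exists>!F. (\<forall>s t. F (s + t) = F s + F t) \<and> (\<forall>r z. F (pure_tensor r z) = f r z)"
proof -
  define g where "g M = (\<Sum>p\<in>#M. f (fst p) (snd p))" for M :: "('a \<times> complex) multiset"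
  have zero: "f 0 z = 0" for z
    using left[of 0 0 z] by simp
  have g: "g M = g N" if "tensor_eq M N" for M N
    using that by induction (auto simp: g_def left right zero)
  define F where "F t = g (rep_complex_tensor t)" for t :: "'a complex_tensor"
  have F: "F (abs_complex_tensor M) = g M" for M
    unfolding F_def
    by (intro g complex_tensor.abs_eq_iff[THEN iffD1] Quotient3_abs_rep[OF Quotient3_complex_tensor])
  show ?thesis
  proof (rule ex1I[of _ F])
    have "F (s + t) = F s + F t" for s t
    proof -
      obtain M N where "s = abs_complex_tensor M" "t = abs_complex_tensor N"
        by (metis Quotient3_abs_rep[OF Quotient3_complex_tensor])
      then show ?thesis
        by (simp add: F plus_complex_tensor.abs_eq g_def)
    qed
    moreover have "F (pure_tensor r z) = f r z" for r z
      by (simp add: pure_tensor.abs_eq F g_def)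
    ultimately show "(\<forall>s t. F (s + t) = F s + F t) \<and> (\<forall>r z. F (pure_tensor r z) = f r z)"
      by blast
  next
    fix F'
    assume F': "(\<forall>s t. F' (s + t) = F' s + F' t) \<and> (\<forall>r z. F' (pure_tensor r z) = f r z)"
    have F'_abs: "F' (abs_complex_tensor M) = g M" for M
    proof (induction M)
      case empty
      have "F' 0 + F' 0 = F' 0"
        using F' by (metis add.right_neutral)
      then show ?case
        by (simp add: g_def flip: zero_complex_tensor.abs_eq)
    next
      case (add p M)
      have "abs_complex_tensor (add_mset p M)
            = pure_tensor (fst p) (snd p) + abs_complex_tensor M"
        by (simp add: pure_tensor.abs_eq plus_complex_tensor.abs_eq)
      then show ?case
        using F' add by (simp add: g_def)
    qed
    show "F' = F"
    proof
      fix t :: "'a complex_tensor"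
      obtain M where "t = abs_complex_tensor M"
        by (metis Quotient3_abs_rep[OF Quotient3_complex_tensor])
      then show "F' t = F t"
        by (simp add: F F'_abs)
    qed
  qed
qed

definition cscale :: "complex \<Rightarrow> 'a::ring_1 complex_tensor \<Rightarrow> 'a complex_tensor" where
  "cscale c t = pure_tensor 1 c * t"

definition to_tensor :: "'a::ring_1 \<Rightarrow> 'a complex_tensor" where
  "to_tensor r = pure_tensor r 1"


section \<open>Algebraic elements and eigenvalues\<close>

definition algebraic_over_rat :: "'a::ring_1 \<Rightarrow> bool" where
  "algebraic_over_rat x \<longleftrightarrow>
     (\<exists>p :: rat poly. p \<noteq> 0 \<and>
        (\<Sum>i\<le>degree p. cscale (of_rat (coeff p i)) (to_tensor x ^ i)) = 0)"

definition transcendental_over_rat :: "'a::ring_1 \<Rightarrow> bool" where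
  "transcendental_over_rat x \<longleftrightarrow> \<not> algebraic_over_rat x"

definition eigenvalues :: "'a::ring_1 \<Rightarrow> complex set" where
  "eigenvalues x = {c. \<exists>t. t \<noteq> 0 \<and> to_tensor x * t = cscale c t}"

end

theory Submission
  imports Defs "HOL-Computational_Algebra.Fundamental_Theorem_Algebra"
begin

text \<open>
  A word in the two generators is evaluated at \<open>1 + a\<close>, \<open>1 + b\<close> by \<open>word_value\<close>, and the pair is
  free exactly if only words that reduce to the empty word have value \<open>1\<close>
  (\<open>free_pair_units_iff\<close>, and \<open>free_complex_iff\<close> for the matrices). Since \<open>R\<close> is torsion-free,
  it embeds into \<open>R \<otimes> \<complex>\<close> (\<open>to_tensor_eq_0_iff\<close>), so everything can be computed there, where
  \<open>x = a b\<close> can be substituted into complex polynomials.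

  The link between the ring and the matrices is the following. Let \<open>M(w)\<close> be the value of the
  word \<open>w\<close> at the two matrices of the definition of free numbers, with an indeterminate \<open>t\<close> in
  place of \<open>z\<close>. Because \<open>a a = b b = 0\<close>, left multiplication by \<open>a\<close> and \<open>b\<close> maps the set of
  elements \<open>x p(x) + b q(x)\<close> into itself, and a word \<open>w\<close> sends the element with coordinates
  \<open>(p, q)\<close> to the one with coordinates \<open>M(w) (p, q)\<close> (\<open>word_value_column_vector\<close>); there is a
  similar row version.

  Suppose first that \<open>w\<close> has value \<open>1\<close> in \<open>R\<close>. Then \<open>t\<^sup>2 q\<close> annihilates \<open>x\<close> for each entry \<open>q\<close>
  of \<open>M(w) - 1\<close> (\<open>word_value_eq_1_annihilator\<close>). These polynomials have rational coefficients.
  So if \<open>x\<close> is transcendental, then \<open>M(w) = 1\<close>, and \<open>w\<close> is trivial because some number, for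
  instance \<open>9\<close>, is free. If \<open>z\<close> is an eigenvalue of \<open>x\<close> that is free, then \<open>z \<noteq> 0\<close> and
  \<open>z\<^sup>2 q(z) = 0\<close>, hence \<open>M(w)\<close> becomes \<open>1\<close> at \<open>t = z\<close> and \<open>w\<close> is trivial again.

  Suppose conversely that \<open>x\<close> is algebraic and that no eigenvalue is free. Let \<open>p\<close> be a
  polynomial of least degree that annihilates \<open>x\<close>; its roots are eigenvalues. For each root \<open>z\<close>
  there is a nontrivial word \<open>w\<close> whose matrix is \<open>1\<close> at \<open>t = z\<close>, so that \<open>M(w)\<close> is congruent to
  \<open>1\<close> modulo \<open>t - z\<close>. The commutator of words that are congruent to \<open>1\<close> modulo \<open>p\<^sub>1\<close> and \<open>p\<^sub>2\<close>
  is congruent to \<open>1\<close> modulo \<open>p\<^sub>1 p\<^sub>2\<close>, so iterated commutators give a word that is congruent to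
  \<open>1\<close> modulo \<open>p\<close> (\<open>ex_word_congruent_one\<close>). The value in \<open>R\<close> of such a word commutes with
  \<open>1 + b\<close> (\<open>congruent_one_imp_centralises\<close>), so its commutator with the second generator has
  value \<open>1\<close>. What makes this work is that the commutators can be kept nontrivial by conjugating
  one of the words (\<open>ex_noncommuting_conjugate\<close>).
\<close>

section \<open>Words and free pairs\<close>

definition trivial_word :: "'s letter list \<Rightarrow> bool" where
  "trivial_word w \<longleftrightarrow> foldr push_letter w [] = []"

definition inv_word :: "'s letter list \<Rightarrow> 's letter list" where
  "inv_word w = map inv_letter (rev w)"

definition commutator_word :: "'s letter list \<Rightarrow> 's letter list \<Rightarrow> 's letter list" where
  "commutator_word u v = u @ v @ inv_word u @ inv_word v"

lemma trivial_word_reduced: "reduced w \<Longrightarrow> trivial_word w \<longleftrightarrow> w = []"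
  by (simp add: trivial_word_def foldr_push_Nil)

lemma not_trivial_letter: "\<not> trivial_word [x]"
  by (simp add: trivial_word_def)

lemma push_letter_map:
  assumes "inj_on f A" "fst x \<in> A" "set w \<subseteq> A \<times> UNIV"
  shows "push_letter (apfst f x) (map (apfst f) w)
           = map (apfst f) (push_letter x w)"
proof (cases w)
  case (Cons y ys)
  have "apfst f y = inv_letter (apfst f x) \<longleftrightarrow> y = inv_letter x"
    using assms Cons by (auto simp: inv_letter_def prod_eq_iff inj_on_eq_iff)
  then show ?thesis
    using Cons by simp
qed simp

text \<open>
  Renaming the generators injectively commutes with cancellation. It moves words between the
  fixed alphabet \<open>bool\<close> and the two generators of a concrete group.
\<close>

lemma foldr_push_letter_map:
  assumes "inj_on f A" "set u \<subseteq> A \<times> UNIV" "set v \<subseteq> A \<times> UNIV"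
  shows "foldr push_letter (map (apfst f) u) (map (apfst f) v)
           = map (apfst f) (foldr push_letter u v)"
  using assms(2)
proof (induction u)
  case (Cons x u)
  have "set (foldr push_letter u v) \<subseteq> A \<times> UNIV"
    using set_foldr_push[of u v] Cons.prems assms(3) by auto
  then show ?case
    using Cons push_letter_map[OF assms(1), of x "foldr push_letter u v"] by auto
qed simp

lemma reduced_map:
  assumes "inj_on f A" "set w \<subseteq> A \<times> UNIV" "reduced w"
  shows "reduced (map (apfst f) w)"
proof -
  have "foldr push_letter (map (apfst f) w) [] = map (apfst f) w"
    using foldr_push_letter_map[OF assms(1,2), of "[]"] foldr_push_Nil[OF assms(3)] by simp
  then show ?thesis
    using reduced_foldr_push[of "[]" "map (apfst f) w"] by simp
qed

text \<open>
  The definition of a free pair asks for an isomorphism with the group of reduced words in the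
  elements \<open>g\<close>, \<open>h\<close> themselves. For computations, words over \<open>bool\<close> are better: the values of
  the four letters are given by \<open>L\<close>, words need not be reduced, and freeness means that the
  evaluation has no kernel beyond the words that cancel completely. The condition on \<open>L\<close> forces
  \<open>L (s, False)\<close> to be the inverse of \<open>L (s, True)\<close>.
\<close>

lemma free_pair_iff:
  fixes G (structure) and L :: "bool letter \<Rightarrow> 'g"
  assumes G: "group G" and L: "\<And>x. L x \<in> carrier G"
    and inv: "\<And>x. L (inv_letter x) \<otimes> L x = \<one>"
  shows "free_pair G (L (True, True)) (L (False, True)) \<longleftrightarrow>
           (\<forall>w. foldr (\<lambda>x m. L x \<otimes> m) w \<one> = \<one> \<longrightarrow> trivial_word w)"
proof -
  interpret group G by fact
  define E where "E w = foldr (\<lambda>x m. L x \<otimes> m) w \<one>" for w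
  define g h where "g = L (True, True)" and "h = L (False, True)"
  note gh = L[of "(True, True)", folded g_def] L[of "(False, True)", folded h_def]
  have E_simps [simp]: "E [] = \<one>" "E (x # w) = L x \<otimes> E w" for x w
    by (simp_all add: E_def)
  have E [simp]: "E w \<in> carrier G" for w
    by (induction w) (use L in auto)
  have inv': "L x \<otimes> L (inv_letter x) = \<one>" for x
    using inv[of "inv_letter x"] by simp
  have E_push: "E (push_letter x w) = L x \<otimes> E w" for x w
  proof (cases w)
    case (Cons y ys)
    then show ?thesis
      using inv'[of x] L E by (auto simp flip: m_assoc)
  qed simp
  have E_foldr: "E (foldr push_letter u v) = E u \<otimes> E v" for u v
    by (induction u) (simp_all add: E_push m_assoc L)
  define H where "H = subgroup_generated G {g, h}"
  have carrier_H: "carrier H = generate G {g, h}"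
    using gh by (simp add: H_def carrier_subgroup_generated Int_absorb1)
  have grpH: "group H"
    by (simp add: H_def)
  have L_True: "L (s, True) = (if s then g else h)" for s
    by (simp add: g_def h_def)
  have L_False: "L (s, False) = inv\<^bsub>G\<^esub> (if s then g else h)" for s
    using inv_equality[of "L (s, False)" "L (s, True)"] inv[of "(s, True)"] L
    by (cases s) (simp_all add: inv_letter_def g_def h_def)

  show ?thesis
  proof
    assume "free_pair G (L (True, True)) (L (False, True))"
    then obtain \<phi> where \<phi>: "\<phi> \<in> iso (free_group {g, h}) H" "\<And>s. s \<in> {g, h} \<Longrightarrow> \<phi> [(s, True)] = s"
      and "g \<noteq> h"
      unfolding free_pair_def free_with_basis_def H_def g_def h_def by blast
    define \<gamma> where "\<gamma> s = (if s then g else h)" for s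
    have inj: "inj_on \<gamma> UNIV" and \<gamma>_in: "\<gamma> s \<in> {g, h}" for s
      using \<open>g \<noteq> h\<close> by (auto simp: \<gamma>_def inj_on_def)
    interpret F: group "free_group {g, h}"
      by (rule group_free_group)
    interpret \<phi>: group_hom "free_group {g, h}" H \<phi>
      using \<phi>(1) grpH F.is_group
      by (auto simp: group_hom_def group_hom_axioms_def iso_def)
    have one_H: "\<one>\<^bsub>H\<^esub> = \<one>" and mult_H: "x \<otimes>\<^bsub>H\<^esub> y = x \<otimes> y" for x y
      by (simp_all add: H_def)
    have map_in: "map (apfst \<gamma>) w \<in> carrier (free_group {g, h})" if "reduced w" for w
      using reduced_map[OF inj _ that] \<gamma>_in by (fastforce simp: free_group_def)
    have \<phi>_letter: "\<phi> [apfst \<gamma> x] = L x" for x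
    proof (cases x)
      case (Pair s e)
      have pos: "\<phi> [(\<gamma> s, True)] = L (s, True)"
        using \<phi>(2)[OF \<gamma>_in[of s]] by (simp add: \<gamma>_def L_True)
      show ?thesis
      proof (cases e)
        case True
        then show ?thesis
          using pos Pair by simp
      next
        case False
        have c: "[(\<gamma> s, e')] \<in> carrier (free_group {g, h})" for e'
          using map_in[of "[(s, e')]"] by (simp add: reduced_def)
        have "[(\<gamma> s, False)] \<otimes>\<^bsub>free_group {g, h}\<^esub> [(\<gamma> s, True)] = \<one>\<^bsub>free_group {g, h}\<^esub>"
          by (simp add: free_group_def inv_letter_def)
        then have "\<phi> [(\<gamma> s, False)] \<otimes>\<^bsub>H\<^esub> \<phi> [(\<gamma> s, True)] = \<one>\<^bsub>H\<^esub>"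
          using \<phi>.hom_mult[OF c c] \<phi>.hom_one by metis
        then have "\<phi> [(\<gamma> s, False)] \<otimes> L (s, True) = \<one>"
          by (simp add: pos one_H mult_H)
        moreover have "\<phi> [(\<gamma> s, False)] \<in> carrier G"
          using \<phi>.hom_closed[OF c] carrier_subgroup_generated_subset by (auto simp: H_def)
        ultimately have "\<phi> [(\<gamma> s, False)] = inv\<^bsub>G\<^esub> L (s, True)"
          using inv_equality L by metis
        then show ?thesis
          using Pair False by (simp add: L_True L_False)
      qed
    qed
    have \<phi>_map: "\<phi> (map (apfst \<gamma>) w) = E w" if "reduced w" for w
      using that
    proof (induction w)
      case Nil
      then show ?case
        using \<phi>.hom_one by (simp add: free_group_def one_H)
    next
      case (Cons x w)
      have r: "reduced w"
        using Cons.prems by (rule reduced_tl)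
      have "foldr push_letter [apfst \<gamma> x] (map (apfst \<gamma>) w) = map (apfst \<gamma>) (x # w)"
        using foldr_push_letter_map[OF inj, of "[x]" w] Cons.prems r
        by (cases w) (auto simp: reduced_def)
      then have "map (apfst \<gamma>) (x # w)
                 = [apfst \<gamma> x] \<otimes>\<^bsub>free_group {g, h}\<^esub> map (apfst \<gamma>) w"
        by (simp add: free_group_def)
      moreover have "[apfst \<gamma> x] \<in> carrier (free_group {g, h})"
        using map_in[of "[x]"] by (simp add: reduced_def)
      ultimately show ?case
        using \<phi>.hom_mult[OF _ map_in[OF r]] Cons.IH[OF r] by (simp add: mult_H \<phi>_letter)
    qed
    show "\<forall>w. foldr (\<lambda>x m. L x \<otimes> m) w \<one> = \<one> \<longrightarrow> trivial_word w"
    proof (intro allI impI)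
      fix w assume "foldr (\<lambda>x m. L x \<otimes> m) w \<one> = \<one>"
      then have w: "E w = \<one>"
        by (simp add: E_def)
      define v where "v = foldr push_letter w []"
      have v: "reduced v"
        by (simp add: v_def reduced_foldr_push)
      have "E v = \<one>"
        using E_foldr[of w "[]"] w by (simp add: v_def)
      then have "\<phi> (map (apfst \<gamma>) v) = \<phi> \<one>\<^bsub>free_group {g, h}\<^esub>"
        using \<phi>_map[OF v] \<phi>.hom_one by (simp add: one_H)
      moreover have "inj_on \<phi> (carrier (free_group {g, h}))"
        using \<phi>(1) by (simp add: iso_def bij_betw_def)
      ultimately have "map (apfst \<gamma>) v = \<one>\<^bsub>free_group {g, h}\<^esub>"
        using inj_onD[OF _ _ map_in[OF v] F.one_closed] by metis
      then show "trivial_word w"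
        by (simp add: free_group_def trivial_word_def v_def)
    qed
  next
    assume "\<forall>w. foldr (\<lambda>x m. L x \<otimes> m) w \<one> = \<one> \<longrightarrow> trivial_word w"
    then have ker: "trivial_word w" if "E w = \<one>" for w
      using that by (simp add: E_def)
    \<comment> \<open>If \<open>g = h\<close>, then the word \<open>g h\<^sup>-\<^sup>1\<close>, which does not cancel, has value \<open>1\<close>.\<close>
    have "g \<noteq> h"
    proof
      assume "g = h"
      then have "E [(True, True), (False, False)] = \<one>"
        using inv'[of "(False, True)"] L by (simp add: L_True inv_letter_def)
      from ker[OF this] show False
        by (simp add: trivial_word_def inv_letter_def)
    qed
    define \<delta> where "\<delta> s = (s = g)" for s
    have inj: "inj_on \<delta> {g, h}"
      using \<open>g \<noteq> h\<close> by (auto simp: \<delta>_def inj_on_def)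
    define \<phi> where "\<phi> w = E (map (apfst \<delta>) w)" for w
    have in_H: "E w \<in> carrier H" for w
    proof (induction w)
      case Nil
      then show ?case
        by (simp add: carrier_H generate.one)
    next
      case (Cons x w)
      have "L x \<in> generate G {g, h}"
        by (cases x; cases "snd x") (auto simp: L_True L_False intro: generate.incl generate.inv)
      then show ?case
        using Cons by (auto simp: carrier_H intro: generate.eng)
    qed
    interpret F: group "free_group {g, h}"
      by (rule group_free_group)
    have hom: "\<phi> \<in> hom (free_group {g, h}) G"
    proof (rule homI)
      fix u v assume "u \<in> carrier (free_group {g, h})" "v \<in> carrier (free_group {g, h})"
      then show "\<phi> (u \<otimes>\<^bsub>free_group {g, h}\<^esub> v) = \<phi> u \<otimes> \<phi> v"
        using foldr_push_letter_map[OF inj, of u v]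
        by (simp add: \<phi>_def free_group_def E_foldr flip: E_foldr)
    qed (simp add: \<phi>_def)
    interpret \<phi>: group_hom "free_group {g, h}" G \<phi>
      using hom by unfold_locales
    have gen: "\<phi> [(s, True)] = s" if "s \<in> {g, h}" for s
      using that gh \<open>g \<noteq> h\<close> by (auto simp: \<phi>_def \<delta>_def L_True)
    have "inj_on \<phi> (carrier (free_group {g, h}))"
      unfolding \<phi>.inj_iff_trivial_ker
    proof -
      have "w = []" if w: "w \<in> carrier (free_group {g, h})" "\<phi> w = \<one>" for w
      proof -
        have "reduced (map (apfst \<delta>) w)"
          using w reduced_map[OF inj] by (simp add: free_group_def)
        then show ?thesis
          using ker[OF w(2)[unfolded \<phi>_def]] trivial_word_reduced by auto
      qed
      then show "kernel (free_group {g, h}) G \<phi> = {\<one>\<^bsub>free_group {g, h}\<^esub>}"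
        using F.one_closed \<phi>.hom_one by (auto simp: kernel_def) (auto simp: free_group_def)
    qed
    moreover have "\<phi> ` carrier (free_group {g, h}) = carrier H"
    proof
      show "\<phi> ` carrier (free_group {g, h}) \<subseteq> carrier H"
        using in_H by (auto simp: \<phi>_def)
      have "s \<in> \<phi> ` carrier (free_group {g, h})" if "s \<in> {g, h}" for s
        using that gen[OF that]
        by (intro image_eqI[of _ _ "[(s, True)]"]) (auto simp: free_group_def reduced_def)
      then show "carrier H \<subseteq> \<phi> ` carrier (free_group {g, h})"
        unfolding carrier_H by (intro generate_subgroup_incl \<phi>.img_is_subgroup subsetI)
    qed
    ultimately have "\<phi> \<in> iso (free_group {g, h}) H"
      using hom in_H by (auto simp: iso_def bij_betw_def hom_def H_def \<phi>_def)
    then show "free_pair G (L (True, True)) (L (False, True))"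
      unfolding free_pair_def free_with_basis_def g_def[symmetric] h_def[symmetric]
      using gh \<open>g \<noteq> h\<close> gen by (auto simp: H_def)
  qed
qed


section \<open>Values of words in square-zero elements\<close>

text \<open>
  The sort is that of a ring with identity in which \<open>0 = 1\<close> is not excluded, because this is the
  structure available on the complex algebra. For square-zero \<open>c\<close> the inverse of \<open>1 + c\<close> is
  \<open>1 - c\<close>.
\<close>

fun letter_value :: "'r \<Rightarrow> 'r \<Rightarrow> bool letter \<Rightarrow> 'r::{ring,monoid_mult}" where
  "letter_value a b (s, e) = (let c = if s then a else b in if e then 1 + c else 1 - c)"

definition word_value :: "'r \<Rightarrow> 'r \<Rightarrow> bool letter list \<Rightarrow> 'r::{ring,monoid_mult}" where
  "word_value a b w = prod_list (map (letter_value a b) w)"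

lemma word_value_simps [simp]:
  "word_value a b [] = 1"
  "word_value a b (x # w) = letter_value a b x * word_value a b w"
  "word_value a b (u @ v) = word_value a b u * word_value a b v"
  by (simp_all add: word_value_def)

lemma letter_value_inv_letter:
  fixes a b :: "'r::{ring,monoid_mult}"
  assumes "a * a = 0" "b * b = 0"
  shows "letter_value a b (inv_letter x) * letter_value a b x = 1"
  using assms by (cases x) (auto simp: inv_letter_def Let_def algebra_simps)

lemma letter_value_inv_letter':
  fixes a b :: "'r::{ring,monoid_mult}"
  assumes "a * a = 0" "b * b = 0"
  shows "letter_value a b x * letter_value a b (inv_letter x) = 1"
  using letter_value_inv_letter[OF assms, of "inv_letter x"] by simp

lemma word_value_push:
  fixes a b :: "'r::{ring,monoid_mult}"
  assumes "a * a = 0" "b * b = 0"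
  shows "word_value a b (push_letter x w) = letter_value a b x * word_value a b w"
proof (cases w)
  case (Cons y ys)
  then show ?thesis
    using letter_value_inv_letter'[OF assms, of x] by (auto simp flip: mult.assoc)
qed simp

lemma word_value_reduce:
  fixes a b :: "'r::{ring,monoid_mult}"
  assumes "a * a = 0" "b * b = 0"
  shows "word_value a b (foldr push_letter w []) = word_value a b w"
  by (induction w) (simp_all add: word_value_push assms)

lemma word_value_trivial:
  fixes a b :: "'r::{ring,monoid_mult}"
  assumes "a * a = 0" "b * b = 0" "trivial_word w"
  shows "word_value a b w = 1"
  using word_value_reduce[OF assms(1,2), of w] assms(3) by (simp add: trivial_word_def)

lemma inv_word_simps [simp]:
  "inv_word [] = []" "inv_word (x # w) = inv_word w @ [inv_letter x]"
  "inv_word (u @ v) = inv_word v @ inv_word u"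
  by (simp_all add: inv_word_def)

lemma inv_word_inv_word [simp]: "inv_word (inv_word w) = w"
  by (induction w) simp_all

lemma word_value_inv_word:
  fixes a b :: "'r::{ring,monoid_mult}"
  assumes "a * a = 0" "b * b = 0"
  shows "word_value a b (inv_word w) * word_value a b w = 1"
proof (induction w)
  case (Cons x w)
  have "word_value a b (inv_word (x # w)) * word_value a b (x # w)
        = word_value a b (inv_word w) * (letter_value a b (inv_letter x) * letter_value a b x)
            * word_value a b w"
    by (simp add: mult.assoc)
  then show ?case
    using Cons letter_value_inv_letter[OF assms] by simp
qed simp

lemma word_value_inv_word':
  fixes a b :: "'r::{ring,monoid_mult}"
  assumes "a * a = 0" "b * b = 0"
  shows "word_value a b w * word_value a b (inv_word w) = 1"
  using word_value_inv_word[OF assms, of "inv_word w"] by simp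

lemma word_value_commutator_eq_1_iff:
  fixes a b :: "'r::{ring,monoid_mult}"
  assumes "a * a = 0" "b * b = 0"
  shows "word_value a b (commutator_word u v) = 1 \<longleftrightarrow>
           word_value a b u * word_value a b v = word_value a b v * word_value a b u"
    (is "?c = 1 \<longleftrightarrow> ?u * ?v = ?v * ?u")
proof -
  let ?u' = "word_value a b (inv_word u)" and ?v' = "word_value a b (inv_word v)"
  have c: "?c = ?u * ?v * (?u' * ?v')"
    by (simp add: commutator_word_def mult.assoc)
  have "?u' * ?v' * (?v * ?u) = ?u' * (?v' * ?v) * ?u" "?v * ?u * (?u' * ?v') = ?v * (?u * ?u') * ?v'"
    by (simp_all only: mult.assoc)
  then have inverse: "?u' * ?v' * (?v * ?u) = 1" "?v * ?u * (?u' * ?v') = 1"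
    by (simp_all add: word_value_inv_word[OF assms] word_value_inv_word'[OF assms])
  show ?thesis
  proof
    assume "?c = 1"
    have "?u * ?v = ?u * ?v * (?u' * ?v' * (?v * ?u))"
      by (simp add: inverse)
    also have "\<dots> = ?c * (?v * ?u)"
      by (simp only: c mult.assoc)
    finally show "?u * ?v = ?v * ?u"
      using \<open>?c = 1\<close> by simp
  qed (simp add: c inverse)
qed

lemma word_value_hom:
  fixes f :: "'r::{ring,monoid_mult} \<Rightarrow> 's::{ring,monoid_mult}"
  assumes "f 1 = 1" "\<And>x y. f (x + y) = f x + f y" "\<And>x y. f (x * y) = f x * f y"
  shows "f (word_value a b w) = word_value (f a) (f b) w"
proof -
  have "f (x - y) = f x - f y" for x y
    using assms(2)[of "x - y" y] by (simp add: eq_diff_eq)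
  then have "f (letter_value a b x) = letter_value (f a) (f b) x" for x
    by (cases x) (simp add: Let_def assms)
  then show ?thesis
    by (induction w) (simp_all add: assms)
qed

lemma free_pair_units_iff:
  fixes a b :: "'r::ring_1"
  assumes "a * a = 0" "b * b = 0"
  shows "free_pair unit_group (1 + a) (1 + b) \<longleftrightarrow>
           (\<forall>w. word_value a b w = 1 \<longrightarrow> trivial_word w)"
proof -
  let ?M = "\<lparr>carrier = UNIV, Group.monoid.mult = (*), one = 1\<rparr> :: 'r monoid"
  have "Group.monoid ?M"
    by unfold_locales (auto simp: mult.assoc)
  then have grp: "group (unit_group :: 'r monoid)"
    unfolding unit_group_def by (rule monoid.units_group)
  have unit: "letter_value a b x \<in> carrier unit_group" for x
    using letter_value_inv_letter[OF assms, of x] letter_value_inv_letter'[OF assms, of x]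
    by (auto simp: unit_group_def units_of_def Units_def)
  have "foldr (\<lambda>x m. letter_value a b x \<otimes>\<^bsub>unit_group\<^esub> m) w \<one>\<^bsub>unit_group\<^esub> = word_value a b w" for w
    by (induction w) (simp_all add: unit_group_def units_of_def)
  then show ?thesis
    using free_pair_iff[where L = "letter_value a b", OF grp unit] letter_value_inv_letter[OF assms]
    by (simp add: unit_group_def units_of_def)
qed


section \<open>Two-by-two matrices\<close>

text \<open>
  Matrices with the matrix product as the class operation \<open>(*)\<close>, so that words in matrices and
  words in ring elements are instances of the same function \<open>word_value\<close>.
\<close>

datatype 'c mat2 = Mat2 (e11: 'c) (e12: 'c) (e21: 'c) (e22: 'c)

instantiation mat2 :: (comm_ring_1) ring_1
begin

definition "0 = Mat2 0 0 0 0"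
definition "1 = Mat2 1 0 0 1"
definition "- A = Mat2 (- e11 A) (- e12 A) (- e21 A) (- e22 A)"
definition "A + B = Mat2 (e11 A + e11 B) (e12 A + e12 B) (e21 A + e21 B) (e22 A + e22 B)"
definition "A - B = Mat2 (e11 A - e11 B) (e12 A - e12 B) (e21 A - e21 B) (e22 A - e22 B)"
definition "A * B = Mat2 (e11 A * e11 B + e12 A * e21 B) (e11 A * e12 B + e12 A * e22 B)
                         (e21 A * e11 B + e22 A * e21 B) (e21 A * e12 B + e22 A * e22 B)"

lemmas mat2_defs = zero_mat2_def one_mat2_def uminus_mat2_def plus_mat2_def minus_mat2_def
  times_mat2_def

instance
  by standard (auto simp: mat2_defs algebra_simps mat2.expand)

end

definition scalar_mat :: "'c::comm_ring_1 \<Rightarrow> 'c mat2" where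
  "scalar_mat c = Mat2 c 0 0 c"

lemma scalar_mat_commute: "A * scalar_mat c = scalar_mat c * A"
  by (simp add: scalar_mat_def mat2_defs mult.commute)

lemma scalar_mat_mult: "scalar_mat (c * d) = scalar_mat c * scalar_mat d"
  by (simp add: scalar_mat_def mat2_defs)

lemma scalar_mat_1: "scalar_mat 1 = 1"
  by (simp add: scalar_mat_def mat2_defs)

abbreviation unit12 :: "'c::comm_ring_1 mat2" where
  "unit12 \<equiv> Mat2 0 1 0 0"

abbreviation unit21 :: "'c::comm_ring_1 \<Rightarrow> 'c mat2" where
  "unit21 z \<equiv> Mat2 0 0 z 0"

definition word_mat :: "'c::comm_ring_1 \<Rightarrow> bool letter list \<Rightarrow> 'c mat2" where
  "word_mat z w = word_value unit12 (unit21 z) w"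

lemma unit_square: "unit12 * unit12 = (0 :: 'c::comm_ring_1 mat2)"
  "unit21 z * unit21 z = (0 :: 'c::comm_ring_1 mat2)"
  by (simp_all add: mat2_defs)

lemma word_mat_simps [simp]:
  "word_mat z [] = 1"
  "word_mat z (x # w) = letter_value unit12 (unit21 z) x * word_mat z w"
  "word_mat z (u @ v) = word_mat z u * word_mat z v"
  by (simp_all add: word_mat_def)

lemmas word_mat_inv_word = word_value_inv_word[OF unit_square, folded word_mat_def]
  and word_mat_inv_word' = word_value_inv_word'[OF unit_square, folded word_mat_def]
  and word_mat_trivial = word_value_trivial[OF unit_square, folded word_mat_def]
  and word_mat_reduce = word_value_reduce[OF unit_square, folded word_mat_def]
  and word_mat_commutator = word_value_commutator_eq_1_iff[OF unit_square, folded word_mat_def]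

lemma free_complex_iff: "free_complex z \<longleftrightarrow> (\<forall>w. word_mat z w = 1 \<longrightarrow> trivial_word w)"
proof -
  define M where "M = (\<lparr>carrier = UNIV, Group.monoid.mult = (**), one = mat 1\<rparr> :: (complex^2^2) monoid)"
  have "Group.monoid M"
    unfolding M_def by unfold_locales (auto simp: matrix_mul_assoc)
  then have grp: "group GL2_complex"
    unfolding GL2_complex_def M_def[symmetric] by (rule monoid.units_group)
  define f :: "complex^2^2 \<Rightarrow> complex mat2"
    where "f A = Mat2 (A $ 1 $ 1) (A $ 1 $ 2) (A $ 2 $ 1) (A $ 2 $ 2)" for A
  define h :: "complex mat2 \<Rightarrow> complex^2^2"
    where "h A = vector [vector [e11 A, e12 A], vector [e21 A, e22 A]]" for A
  have fh: "f (h A) = A" for A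
    by (simp add: f_def h_def)
  have hf: "h (f A) = A" for A
    by (simp add: f_def h_def vec_eq_iff forall_2)
  have f_mult: "f (A ** B) = f A * f B" for A B
    by (simp add: f_def matrix_matrix_mult_def sum_2 mat2_defs)
  have f_1: "f (mat 1) = 1"
    by (simp add: f_def mat_def mat2_defs)
  have f_eq: "f A = f B \<longleftrightarrow> A = B" for A B
    by (metis hf)
  have h_mult: "h A ** h B = h (A * B)" for A B
    by (metis f_eq f_mult fh)
  have h_1: "h 1 = mat 1"
    by (metis f_eq f_1 fh)
  define L where "L x = h (letter_value unit12 (unit21 z) x)" for x
  have inv: "L (inv_letter x) ** L x = mat 1" "L x ** L (inv_letter x) = mat 1" for x
    using letter_value_inv_letter[OF unit_square, of z x]
      letter_value_inv_letter'[OF unit_square, of z x]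
    by (simp_all add: L_def h_mult h_1)
  have unit: "L x \<in> carrier GL2_complex" for x
    using inv[of x] by (auto simp: GL2_complex_def units_of_def Units_def)
  have "foldr (\<lambda>x m. L x \<otimes>\<^bsub>GL2_complex\<^esub> m) w \<one>\<^bsub>GL2_complex\<^esub> = h (word_mat z w)" for w
    by (induction w) (simp_all add: GL2_complex_def units_of_def L_def h_mult h_1)
  moreover have "h A = mat 1 \<longleftrightarrow> A = 1" for A
    by (metis f_1 fh h_1)
  moreover have "\<one>\<^bsub>GL2_complex\<^esub> = mat 1"
    "L (inv_letter x) \<otimes>\<^bsub>GL2_complex\<^esub> L x = \<one>\<^bsub>GL2_complex\<^esub>" for x
    using inv by (simp_all add: GL2_complex_def units_of_def)
  moreover have "L (True, True) = vector [vector [1, 1], vector [0, 1]]"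
    "L (False, True) = vector [vector [1, 0], vector [z, 1]]"
    by (simp_all add: L_def h_def mat2_defs)
  ultimately show ?thesis
    using free_pair_iff[where L = L, OF grp unit] by (simp add: free_complex_def)
qed


section \<open>A faithful representation of the free group\<close>

text \<open>
  Ping-pong at \<open>z = 9\<close>. On a vector \<open>(x, y)\<close> the generators act by \<open>x \<mapsto> x \<plusminus> y\<close> and
  \<open>y \<mapsto> y \<plusminus> 9 x\<close>; in the coordinates \<open>3 x\<close> and \<open>y\<close> both add or subtract three times the other
  coordinate. Starting from \<open>(1, 3)\<close>, where the two coordinates agree, each letter makes its
  coordinate the strictly larger one in absolute value, and the relative sign of the coordinates
  records the sign of the last letter. A further letter that does not cancel the previous one
  therefore cannot undo this. The number \<open>9\<close> is large enough that one start vector serves all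
  four letters.
\<close>

lemma word_mat_9_reduced:
  assumes "reduced w" "w \<noteq> []"
  shows "\<exists>x y :: int.
           e11 (word_mat (9::complex) w) + 3 * e12 (word_mat 9 w) = of_int x \<and>
           e21 (word_mat (9::complex) w) + 3 * e22 (word_mat 9 w) = of_int y \<and>
           (if fst (hd w)
            then if snd (hd w) then 0 < y \<and> y < 3 * x \<or> 3 * x < y \<and> y < 0
                 else 0 < y \<and> y < - 3 * x \<or> - 3 * x < y \<and> y < 0
            else if snd (hd w) then 0 < 3 * x \<and> 3 * x < y \<or> y < 3 * x \<and> 3 * x < 0
                 else 0 < 3 * x \<and> 3 * x < - y \<or> - y < 3 * x \<and> 3 * x < 0)"
  using assms
proof (induction w)
  case (Cons l w)
  obtain s e where l: "l = (s, e)"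
    by (cases l)
  show ?case
  proof (cases w)
    case Nil
    show ?thesis
      by (rule exI[of _ "if s then if e then 4 else - 2 else 1"],
          rule exI[of _ "if s then 3 else if e then 12 else - 6"])
        (simp add: Nil l mat2_defs)
  next
    case (Cons l' w')
    have "reduced w" "w \<noteq> []"
      using reduced_tl[OF Cons.prems(1)] Cons by auto
    from Cons.IH[OF this] obtain x y :: int where xy:
      "e11 (word_mat (9::complex) w) + 3 * e12 (word_mat 9 w) = of_int x"
      "e21 (word_mat (9::complex) w) + 3 * e22 (word_mat 9 w) = of_int y"
      and reg: "(if fst (hd w)
            then if snd (hd w) then 0 < y \<and> y < 3 * x \<or> 3 * x < y \<and> y < 0
                 else 0 < y \<and> y < - 3 * x \<or> - 3 * x < y \<and> y < 0
            else if snd (hd w) then 0 < 3 * x \<and> 3 * x < y \<or> y < 3 * x \<and> 3 * x < 0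
                 else 0 < 3 * x \<and> 3 * x < - y \<or> - y < 3 * x \<and> 3 * x < 0)"
      by blast
    obtain s' e' where l': "l' = (s', e')"
      by (cases l')
    have ne: "\<not> (s' = s \<and> e' = (\<not> e))"
      using Cons.prems(1) Cons l l' by (auto simp: reduced_def inv_letter_def)
    let ?x = "if s then if e then x + y else x - y else x"
    let ?y = "if s then y else if e then y + 9 * x else y - 9 * x"
    have "e11 (word_mat (9::complex) (l # w)) + 3 * e12 (word_mat 9 (l # w)) = of_int ?x"
      "e21 (word_mat (9::complex) (l # w)) + 3 * e22 (word_mat 9 (l # w)) = of_int ?y"
      unfolding l by (simp_all add: mat2_defs algebra_simps flip: xy)
    moreover have "if s
            then if e then 0 < ?y \<and> ?y < 3 * ?x \<or> 3 * ?x < ?y \<and> ?y < 0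
                 else 0 < ?y \<and> ?y < - 3 * ?x \<or> - 3 * ?x < ?y \<and> ?y < 0
            else if e then 0 < 3 * ?x \<and> 3 * ?x < ?y \<or> ?y < 3 * ?x \<and> 3 * ?x < 0
                 else 0 < 3 * ?x \<and> 3 * ?x < - ?y \<or> - ?y < 3 * ?x \<and> 3 * ?x < 0"
      using reg ne unfolding Cons l' by (cases s; cases e; cases s'; cases e') auto
    ultimately show ?thesis
      unfolding list.sel l fst_conv snd_conv by blast
  qed
qed simp

text \<open>
  A scalar matrix would keep the coordinates \<open>3 x\<close> and \<open>y\<close> of the vector \<open>(1, 3)\<close> equal. That
  scalars other than \<open>1\<close> are excluded as well is what the argument on centralisers below
  requires.
\<close>

lemma word_mat_9_not_scalar:
  assumes "\<not> trivial_word w"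
  shows "word_mat (9::complex) w \<noteq> scalar_mat c"
proof
  assume eq: "word_mat 9 w = scalar_mat c"
  define v where "v = foldr push_letter w []"
  have "reduced v" "v \<noteq> []"
    using assms by (simp_all add: v_def reduced_foldr_push trivial_word_def)
  from word_mat_9_reduced[OF this] obtain x y :: int where
    "e11 (word_mat (9::complex) v) + 3 * e12 (word_mat 9 v) = of_int x"
    "e21 (word_mat (9::complex) v) + 3 * e22 (word_mat 9 v) = of_int y"
    and xy: "y \<noteq> 3 * x"
    by (fastforce split: if_splits)
  moreover have "word_mat (9::complex) v = scalar_mat c"
    using eq word_mat_reduce[of "9::complex" w] by (simp add: v_def)
  ultimately have "of_int y = (3 * of_int x :: complex)"
    by (simp add: scalar_mat_def)
  then have "of_int y = (of_int (3 * x) :: complex)"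
    by simp
  then show False
    using xy by (simp only: of_int_eq_iff)
qed

text \<open>
  Otherwise the matrix of \<open>u\<close> commutes with the whole span of the conjugates of the matrix \<open>V\<close>
  of \<open>v\<close>. Let \<open>D\<close> be the set of matrices all of whose conjugates commute with that of \<open>u\<close>. It is
  a subspace stable under conjugation by \<open>1 \<plusminus> a\<close> and \<open>1 \<plusminus> b\<close>, where \<open>a\<close> and \<open>b\<close> are multiples of
  matrix units, hence stable under \<open>Z \<mapsto> a Z a\<close> and \<open>Z \<mapsto> a Z - Z a\<close> and likewise for \<open>b\<close>. As \<open>V\<close>
  is not scalar, these operations produce \<open>a\<close> or \<open>b\<close>, then both, and a matrix that commutes with
  \<open>a\<close> and \<open>b\<close> is scalar.
\<close>

lemma ex_noncommuting_conjugate: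
  fixes u v :: "bool letter list"
  assumes "\<not> trivial_word u" "\<not> trivial_word v"
  shows "\<exists>w. \<not> trivial_word (commutator_word u (w @ v @ inv_word w))"
proof (rule ccontr)
  assume all: "\<not> ?thesis"
  define a b :: "complex mat2" where "a = unit12" and "b = unit21 9"
  let ?W = "word_mat (9::complex)"
  define D where "D = {Z. \<forall>w. ?W u * (?W w * Z * ?W (inv_word w)) = ?W w * Z * ?W (inv_word w) * ?W u}"
  have conj: "?W w * Z * ?W (inv_word w) \<in> D" if "Z \<in> D" for w Z
  proof -
    have *: "?W w' * (?W w * Z * ?W (inv_word w)) * ?W (inv_word w')
          = ?W (w' @ w) * Z * ?W (inv_word (w' @ w))" for w'
      by (simp add: mult.assoc)
    show ?thesis
      using that unfolding D_def mem_Collect_eq * by blast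
  qed
  have D_add: "Y + Z \<in> D" and D_diff: "Y - Z \<in> D" if "Y \<in> D" "Z \<in> D" for Y Z
    using that unfolding D_def by (auto simp: algebra_simps)
  have D_scale: "Z \<in> D" if "scalar_mat c * Z \<in> D" "c \<noteq> 0" for c Z
  proof -
    have "?W u * (?W w * Z * ?W (inv_word w)) = ?W w * Z * ?W (inv_word w) * ?W u" for w
    proof -
      have "scalar_mat c * (?W u * (?W w * Z * ?W (inv_word w)))
            = scalar_mat c * (?W w * Z * ?W (inv_word w) * ?W u)"
      proof -
        have "?W u * (?W w * (scalar_mat c * Z) * ?W (inv_word w))
              = ?W w * (scalar_mat c * Z) * ?W (inv_word w) * ?W u"
          using that(1) by (simp add: D_def)
        moreover have "Y * (scalar_mat c * Y') = scalar_mat c * (Y * Y')" for Y Y'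
          by (simp add: scalar_mat_def mat2_defs algebra_simps)
        ultimately show ?thesis
          by (simp add: mult.assoc)
      qed
      moreover have "Y = scalar_mat (inverse c) * (scalar_mat c * Y)" for Y
        using that(2) by (simp add: scalar_mat_1 flip: mult.assoc scalar_mat_mult)
      ultimately show ?thesis
        by metis
    qed
    then show ?thesis
      by (simp add: D_def)
  qed
  have D_sandwich: "c * Z * c \<in> D" and D_bracket: "c * Z - Z * c \<in> D"
    if "Z \<in> D" "c = a \<or> c = b" for c Z
  proof -
    define s where "s = (c = a)"
    have "(1 + c) * Z * (1 - c) \<in> D" "(1 - c) * Z * (1 + c) \<in> D"
      using conj[OF that(1), of "[(s, True)]"] conj[OF that(1), of "[(s, False)]"] that(2)
      by (auto simp: s_def inv_letter_def Let_def a_def b_def split: if_splits)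
    from D_add[OF this] D_diff[OF this]
    have *: "(1 + c) * Z * (1 - c) + (1 - c) * Z * (1 + c) \<in> D"
      "(1 + c) * Z * (1 - c) - (1 - c) * Z * (1 + c) \<in> D" .
    have two: "scalar_mat 2 * Y = Y + Y" for Y :: "complex mat2"
      by (simp add: scalar_mat_def mat2_defs)
    \<comment> \<open>The sum and the difference of the two conjugates of \<open>Z\<close> are \<open>2 (Z - c Z c)\<close> and \<open>2 (c Z - Z c)\<close>.\<close>
    have "scalar_mat 2 * (c * Z * c) = Z + Z - ((1 + c) * Z * (1 - c) + (1 - c) * Z * (1 + c))"
      "scalar_mat 2 * (c * Z - Z * c) = (1 + c) * Z * (1 - c) - (1 - c) * Z * (1 + c)"
      by (simp_all add: two algebra_simps)
    then have "scalar_mat 2 * (c * Z * c) \<in> D" "scalar_mat 2 * (c * Z - Z * c) \<in> D"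
      using * D_diff D_add that(1) by simp_all
    then show "c * Z * c \<in> D" "c * Z - Z * c \<in> D"
      using D_scale by auto
  qed
  have ab: "a \<in> D \<and> b \<in> D" if "a \<in> D \<or> b \<in> D"
  proof -
    have "b * a * b = scalar_mat 9 * b" "a * b * a = scalar_mat 9 * a"
      by (simp_all add: a_def b_def scalar_mat_def mat2_defs)
    then show ?thesis
      using that D_sandwich[of a b] D_sandwich[of b a] D_scale[of 9 a] D_scale[of 9 b] by auto
  qed
  define V where "V = ?W v"
  have V: "V \<in> D"
    unfolding D_def V_def
  proof (safe)
    fix w
    have "trivial_word (commutator_word u (w @ v @ inv_word w))"
      using all by blast
    from word_mat_trivial[OF this, of "9::complex"]
    show "?W u * (?W w * ?W v * ?W (inv_word w)) = ?W w * ?W v * ?W (inv_word w) * ?W u"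
      by (simp add: word_mat_commutator mult.assoc)
  qed
  have "a \<in> D \<or> b \<in> D"
  proof (cases "e21 V = 0 \<and> e12 V = 0")
    case False
    have "a * V * a = scalar_mat (e21 V) * a" "b * V * b = scalar_mat (9 * e12 V) * b"
      by (simp_all add: a_def b_def scalar_mat_def mat2_defs)
    then show ?thesis
      using False D_sandwich[OF V, of a] D_sandwich[OF V, of b] D_scale[of "e21 V" a]
        D_scale[of "9 * e12 V" b] by auto
  next
    case True
    have "e11 V \<noteq> e22 V"
    proof
      assume "e11 V = e22 V"
      then have "V = scalar_mat (e11 V)"
        using True by (simp add: scalar_mat_def mat2.expand)
      then show False
        using word_mat_9_not_scalar[OF assms(2)] by (simp add: V_def)
    qed
    moreover have "a * V - V * a = scalar_mat (e22 V - e11 V) * a"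
      using True by (simp add: a_def scalar_mat_def mat2_defs)
    ultimately show ?thesis
      using D_bracket[OF V, of a] D_scale[of "e22 V - e11 V" a] by auto
  qed
  with ab have "a \<in> D" "b \<in> D"
    by auto
  then have "?W u * a = a * ?W u" "?W u * b = b * ?W u"
    unfolding D_def by (auto dest!: spec[of _ "[]"])
  then have "?W u = scalar_mat (e11 (?W u))"
    by (auto simp: a_def b_def scalar_mat_def mat2_defs mat2.expand)
  then show False
    using word_mat_9_not_scalar[OF assms(1)] by blast
qed


section \<open>Words congruent to the identity modulo a polynomial\<close>

definition congruent_one :: "'c::comm_ring_1 \<Rightarrow> 'c mat2 \<Rightarrow> bool" where
  "congruent_one p X \<longleftrightarrow> (\<exists>A. X = 1 + scalar_mat p * A)"

lemma congruent_one_conjugate: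
  assumes "congruent_one p X" "Y * Y' = 1"
  shows "congruent_one p (Y * X * Y')"
proof -
  obtain A where "X = 1 + scalar_mat p * A"
    using assms(1) by (auto simp: congruent_one_def)
  then have "Y * X * Y' = Y * Y' + scalar_mat p * (Y * A * Y')"
    by (simp add: algebra_simps) (simp add: scalar_mat_commute flip: mult.assoc)
  then show ?thesis
    using assms(2) by (auto simp: congruent_one_def)
qed

text \<open>
  If \<open>X = 1 + p A\<close> and \<open>Y = 1 + q B\<close>, then \<open>X Y - Y X = p q (A B - B A)\<close>.
\<close>

lemma congruent_one_commutator:
  assumes "congruent_one p X" "congruent_one q Y" "X * X' = 1" "Y * Y' = 1"
  shows "congruent_one (p * q) (X * Y * X' * Y')"
proof -
  obtain A B where A: "X = 1 + scalar_mat p * A" and B: "Y = 1 + scalar_mat q * B"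
    using assms by (auto simp: congruent_one_def)
  have "X * Y = Y * X + scalar_mat (p * q) * (A * B - B * A)"
    unfolding A B by (simp add: scalar_mat_def mat2_defs algebra_simps)
  then have "X * Y * X' * Y' = (Y * X + scalar_mat (p * q) * (A * B - B * A)) * X' * Y'"
    by simp
  also have "\<dots> = Y * (X * X') * Y' + scalar_mat (p * q) * ((A * B - B * A) * X' * Y')"
    by (simp only: distrib_right mult.assoc)
  finally show ?thesis
    using assms(3,4) by (auto simp: congruent_one_def)
qed

abbreviation generic_word_mat :: "bool letter list \<Rightarrow> complex poly mat2" where
  "generic_word_mat \<equiv> word_mat [:0, 1:]"

lemma poly_generic_word_mat:
  "poly (e11 (generic_word_mat w)) z = e11 (word_mat z w)"
  "poly (e12 (generic_word_mat w)) z = e12 (word_mat z w)"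
  "poly (e21 (generic_word_mat w)) z = e21 (word_mat z w)"
  "poly (e22 (generic_word_mat w)) z = e22 (word_mat z w)"
proof -
  define f where "f A = Mat2 (poly (e11 A) z) (poly (e12 A) z) (poly (e21 A) z) (poly (e22 A) z)" for A
  have "f (generic_word_mat w) = word_value (f unit12) (f (unit21 [:0, 1:])) w"
    unfolding word_mat_def by (rule word_value_hom) (simp_all add: f_def mat2_defs)
  then have "f (generic_word_mat w) = word_mat z w"
    by (simp add: f_def word_mat_def)
  then show "poly (e11 (generic_word_mat w)) z = e11 (word_mat z w)"
    "poly (e12 (generic_word_mat w)) z = e12 (word_mat z w)"
    "poly (e21 (generic_word_mat w)) z = e21 (word_mat z w)"
    "poly (e22 (generic_word_mat w)) z = e22 (word_mat z w)"
    by (simp_all add: f_def flip: \<open>f (generic_word_mat w) = word_mat z w\<close>)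
qed

lemma congruent_one_linear_factor:
  assumes "word_mat z w = 1"
  shows "congruent_one [:- z, 1:] (generic_word_mat w)"
proof -
  let ?M = "generic_word_mat w"
  have "[:- z, 1:] dvd e11 ?M - 1" "[:- z, 1:] dvd e12 ?M" "[:- z, 1:] dvd e21 ?M"
    "[:- z, 1:] dvd e22 ?M - 1"
    by (simp_all add: poly_generic_word_mat assms one_mat2_def flip: poly_eq_0_iff_dvd)
  then obtain p q r s where "e11 ?M - 1 = [:- z, 1:] * p" "e12 ?M = [:- z, 1:] * q"
    "e21 ?M = [:- z, 1:] * r" "e22 ?M - 1 = [:- z, 1:] * s"
    by (meson dvdE)
  then have "?M = 1 + scalar_mat [:- z, 1:] * Mat2 p q r s"
    by (intro mat2.expand) (simp add: scalar_mat_def mat2_defs diff_eq_eq add.commute)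
  then show ?thesis
    by (auto simp: congruent_one_def)
qed

text \<open>
  Each linear factor \<open>t - z\<close> of \<open>p\<close> contributes a nontrivial word whose matrix is \<open>1\<close> at
  \<open>t = z\<close>. The induction on the degree takes the commutator with such a word, conjugated so that
  the commutator does not become trivial; conjugation preserves the congruence.
\<close>

lemma ex_word_congruent_one:
  assumes "p \<noteq> 0" "\<And>z. poly p z = 0 \<Longrightarrow> \<not> free_complex z"
  shows "\<exists>w. \<not> trivial_word w \<and> congruent_one p (generic_word_mat w)"
  using assms
proof (induction "degree p" arbitrary: p)
  case 0
  then obtain c where c: "p = [:c:]" "c \<noteq> 0"
    by (metis degree_eq_zeroE pCons_0_0)
  have "X = 1 + scalar_mat p * (scalar_mat [:inverse c:] * (X - 1))" for X
    using c by (simp add: scalar_mat_1 flip: mult.assoc scalar_mat_mult one_pCons)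
  then have "congruent_one p (generic_word_mat [(True, True)])"
    unfolding congruent_one_def by blast
  then show ?case
    using not_trivial_letter by blast
next
  case (Suc n)
  then have "\<not> constant (poly p)"
    by (simp add: constant_degree)
  then obtain z where z: "poly p z = 0"
    using fundamental_theorem_of_algebra by blast
  then obtain q where q: "p = [:- z, 1:] * q"
    by (metis dvdE poly_eq_0_iff_dvd)
  have "q \<noteq> 0"
    using q Suc.prems by auto
  then have "n = degree q"
    using Suc.hyps(2) unfolding q by (subst (asm) degree_mult_eq) auto
  from Suc.hyps(1)[OF this \<open>q \<noteq> 0\<close>] obtain u where
    u: "\<not> trivial_word u" "congruent_one q (generic_word_mat u)"
    using Suc.prems(2) q by auto
  obtain v where v: "\<not> trivial_word v" "word_mat z v = 1"
    using Suc.prems(2)[OF z] by (auto simp: free_complex_iff)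
  obtain w where w: "\<not> trivial_word (commutator_word u (w @ v @ inv_word w))"
    using ex_noncommuting_conjugate[OF u(1) v(1)] by blast
  have "congruent_one [:- z, 1:] (generic_word_mat (w @ v @ inv_word w))"
    using congruent_one_conjugate[OF congruent_one_linear_factor[OF v(2)] word_mat_inv_word']
    by (simp add: mult.assoc)
  from congruent_one_commutator[OF u(2) this word_mat_inv_word' word_mat_inv_word']
  have "congruent_one p (generic_word_mat (commutator_word u (w @ v @ inv_word w)))"
    by (simp add: commutator_word_def mult.assoc q mult.commute[of q])
  then show ?case
    using w by blast
qed


section \<open>Polynomials in an element of the complex algebra\<close>

text \<open>
  Every element is a finite sum of pure tensors.
\<close>

lemma tensor_induct [case_names zero add]:
  assumes "P 0" "\<And>r z t. P t \<Longrightarrow> P (pure_tensor r z + t)"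
  shows "P t"
proof -
  have "P (abs_complex_tensor M)" for M
  proof (induction M)
    case empty
    then show ?case
      using assms(1) by (simp add: zero_complex_tensor.abs_eq)
  next
    case (add p M)
    then show ?case
      using assms(2)[OF add, of "fst p" "snd p"]
      by (simp add: pure_tensor.abs_eq plus_complex_tensor.abs_eq)
  qed
  then show ?thesis
    by (metis Quotient3_abs_rep[OF Quotient3_complex_tensor])
qed

lemma pure_tensor_zero_right: "pure_tensor r 0 = 0"
  using pure_tensor_add_right[of r 0 0] by simp

lemma cscale_commute: "t * pure_tensor 1 c = cscale c t"
  unfolding cscale_def
  by (induction t rule: tensor_induct) (simp_all add: algebra_simps pure_tensor_mult mult.commute)

lemma cscale_add_left: "cscale (c + d) t = cscale c t + cscale d t"
  and cscale_add_right: "cscale c (s + t) = cscale c s + cscale c t"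
  and cscale_0_left [simp]: "cscale 0 t = 0"
  and cscale_0_right [simp]: "cscale c 0 = 0"
  and cscale_1 [simp]: "cscale 1 t = t"
  and cscale_mult_left: "cscale c s * t = cscale c (s * t)"
  by (simp_all add: cscale_def pure_tensor_add_right distrib_right distrib_left
      pure_tensor_zero_right pure_tensor_one mult.assoc)

lemma cscale_cscale: "cscale c (cscale d t) = cscale (c * d) t"
  by (simp add: cscale_def pure_tensor_mult flip: mult.assoc)

lemma cscale_mult_right: "s * cscale c t = cscale c (s * t)"
  by (metis cscale_commute cscale_def mult.assoc)

lemma cscale_eq_0_iff: "cscale c t = 0 \<longleftrightarrow> c = 0 \<or> t = 0"
proof -
  have "t = cscale (inverse c) (cscale c t)" if "c \<noteq> 0"
    using that by (simp add: cscale_cscale)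
  then show ?thesis
    by (metis cscale_0_left cscale_0_right)
qed

definition poly_value :: "complex poly \<Rightarrow> 'a::ring_1 complex_tensor \<Rightarrow> 'a complex_tensor" where
  "poly_value p x = (\<Sum>i\<le>degree p. cscale (coeff p i) (x ^ i))"

lemma poly_value_0 [simp]: "poly_value 0 x = 0"
  by (simp add: poly_value_def)

lemma poly_value_pCons [simp]: "poly_value (pCons c p) x = cscale c 1 + x * poly_value p x"
proof (cases "p = 0")
  case False
  then show ?thesis
    by (simp add: poly_value_def sum.atMost_Suc_shift sum_distrib_left cscale_mult_right
        del: sum.atMost_Suc)
qed (simp add: poly_value_def)

lemma poly_value_add: "poly_value (p + q) x = poly_value p x + poly_value q x"
  by (induction p q rule: poly_induct2) (simp_all add: cscale_add_left algebra_simps)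

lemma poly_value_diff: "poly_value (p - q) x = poly_value p x - poly_value q x"
  using poly_value_add[of "p - q" q x] by (simp add: eq_diff_eq)

lemma poly_value_smult: "poly_value (smult c p) x = cscale c (poly_value p x)"
  by (induction p) (simp_all add: cscale_add_right cscale_cscale cscale_mult_right)

lemma poly_value_mult: "poly_value (p * q) x = poly_value p x * poly_value q x"
  by (induction p)
    (simp_all add: poly_value_add poly_value_smult cscale_mult_left distrib_right mult.assoc)

lemma poly_value_1 [simp]: "poly_value 1 x = 1"
  by (simp add: one_pCons)

lemma poly_value_commute: "x * poly_value p x = poly_value p x * x"
  by (induction p)
    (simp_all add: distrib_left distrib_right cscale_mult_left cscale_mult_right flip: mult.assoc)

lemma poly_value_eigenvector:
  assumes "x * t = cscale z t"
  shows "poly_value p x * t = cscale (poly p z) t"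
  by (induction p)
    (simp_all add: distrib_right cscale_mult_left cscale_mult_right cscale_cscale assms mult.assoc
      cscale_add_left mult.commute)


section \<open>The action of words on polynomials\<close>

text \<open>
  Let \<open>a a = b b = 0\<close>. In terms of \<open>x = a b\<close>, the elements \<open>x p(x) + b q(x)\<close> are stable under
  left multiplication by \<open>a\<close> and \<open>b\<close>: \<open>a\<close> kills \<open>x p(x)\<close> and turns \<open>b q(x)\<close> into \<open>x q(x)\<close>, while
  \<open>b\<close> kills \<open>b q(x)\<close> and turns \<open>x p(x)\<close> into \<open>b (t p)(x)\<close>. In coordinates these maps are the two
  square-zero matrices from which \<open>generic_word_mat\<close> is built.
\<close>

definition column_vector :: "'a::ring_1 complex_tensor \<Rightarrow> 'a complex_tensor \<Rightarrow>
    complex poly \<Rightarrow> complex poly \<Rightarrow> 'a complex_tensor" where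
  "column_vector a b p q = a * b * poly_value p (a * b) + b * poly_value q (a * b)"

text \<open>
  The elements \<open>b p(x) + b q(x) a\<close> play the same role for right multiplication: \<open>a\<close> turns
  \<open>b p(x)\<close> into \<open>b p(x) a\<close>, and \<open>b\<close> turns \<open>b q(x) a\<close> into \<open>b (t q)(x)\<close>.
\<close>

definition row_vector :: "'a::ring_1 complex_tensor \<Rightarrow> 'a complex_tensor \<Rightarrow>
    complex poly \<Rightarrow> complex poly \<Rightarrow> 'a complex_tensor" where
  "row_vector a b p q = b * poly_value p (a * b) + b * poly_value q (a * b) * a"

lemma word_value_column_vector:
  fixes a b :: "'a::ring_1 complex_tensor" and w
  defines "M \<equiv> generic_word_mat w"
  assumes "a * a = 0" "b * b = 0"
  shows "word_value a b w * column_vector a b p q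
         = column_vector a b (e11 M * p + e12 M * q) (e21 M * p + e22 M * q)"
  unfolding M_def
proof (induction w)
  case Nil
  show ?case
    by (simp add: one_mat2_def)
next
  case (Cons x w)
  define t :: "complex poly" where "t = [:0, 1:]"
  have t: "poly_value t y = y" for y :: "'a complex_tensor"
    by (simp add: t_def)
  have a: "a * column_vector a b f g = a * b * poly_value g (a * b)" for f g
    using assms(2) by (simp add: column_vector_def distrib_left flip: mult.assoc)
  have b: "b * column_vector a b f g = b * poly_value (t * f) (a * b)" for f g
  proof -
    have "b * (b * t) = 0" for t
      by (simp add: assms(3) flip: mult.assoc)
    then show ?thesis
      by (simp add: column_vector_def distrib_left mult.assoc poly_value_mult t)
  qed
  obtain s e where x: "x = (s, e)"
    by (cases x)
  have "letter_value a b x * column_vector a b f g =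
        (if s then if e then column_vector a b (f + g) g else column_vector a b (f - g) g
         else if e then column_vector a b f (g + t * f) else column_vector a b f (g - t * f))"
    for f g
    by (simp add: x Let_def distrib_right left_diff_distrib a b)
      (simp add: column_vector_def poly_value_add poly_value_diff poly_value_mult t algebra_simps)
  then show ?case
    using Cons.IH by (simp add: mult.assoc) (simp add: x mat2_defs algebra_simps flip: t_def)
qed

lemma row_vector_word_value:
  fixes a b :: "'a::ring_1 complex_tensor" and w
  defines "M \<equiv> generic_word_mat w"
  assumes "a * a = 0" "b * b = 0"
  shows "row_vector a b p q * word_value a b w
         = row_vector a b (p * e11 M + q * e21 M) (p * e12 M + q * e22 M)"
  unfolding M_def
proof (induction w arbitrary: p q)
  case Nil
  show ?case
    by (simp add: one_mat2_def)
next
  case (Cons x w)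
  define t :: "complex poly" where "t = [:0, 1:]"
  have t: "poly_value t y = y" for y :: "'a complex_tensor"
    by (simp add: t_def)
  have a: "row_vector a b f g * a = b * poly_value f (a * b) * a" for f g
    using assms(2) by (simp add: row_vector_def distrib_right mult.assoc poly_value_mult t)
  \<comment> \<open>The constant term of \<open>f\<close> contributes a multiple of \<open>b b\<close>, and every other term ends in \<open>a b b\<close>.\<close>
  have bpb: "b * (poly_value f (a * b) * b) = 0" for f
  proof (cases f)
    case (pCons c f')
    have "a * b * poly_value f' (a * b) * b = poly_value f' (a * b) * a * (b * b)"
      by (simp add: poly_value_commute mult.assoc)
    then show ?thesis
      using pCons by (simp add: distrib_right cscale_mult_left cscale_mult_right assms(3))
  qed
  have b: "row_vector a b f g * b = b * poly_value (t * g) (a * b)" for f g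
    using poly_value_commute[of "a * b" g] bpb[of f]
    by (simp add: row_vector_def distrib_right mult.assoc poly_value_mult t)
  obtain s e where x: "x = (s, e)"
    by (cases x)
  have "row_vector a b f g * letter_value a b x =
        (if s then if e then row_vector a b f (g + f) else row_vector a b f (g - f)
         else if e then row_vector a b (f + t * g) g else row_vector a b (f - t * g) g)"
    for f g
    by (simp add: x Let_def distrib_left right_diff_distrib a b)
      (simp add: row_vector_def poly_value_add poly_value_diff poly_value_mult t algebra_simps)
  then show ?case
    by (simp add: Cons.IH flip: mult.assoc)
      (simp add: x mat2_defs algebra_simps flip: t_def)
qed

text \<open>
  The element \<open>b\<close> has column coordinates \<open>(0, 1)\<close> and row coordinates \<open>(1, 0)\<close>. Modulo \<open>p\<close> the
  matrix of \<open>w\<close> fixes both, so the value of \<open>w\<close> fixes \<open>b\<close> under multiplication from either side.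
\<close>

lemma congruent_one_imp_centralises:
  assumes "a * a = 0" "b * b = 0"
    and "congruent_one p (generic_word_mat w)" "poly_value p (a * b) = 0"
  shows "word_value a b w * (1 + b) = (1 + b) * word_value a b w"
proof -
  obtain A where A: "generic_word_mat w = 1 + scalar_mat p * A"
    using assms(3) by (auto simp: congruent_one_def)
  have "word_value a b w * column_vector a b 0 1 = column_vector a b 0 1"
    by (simp add: word_value_column_vector[OF assms(1,2)] A)
      (simp add: column_vector_def scalar_mat_def mat2_defs poly_value_add poly_value_mult assms(4))
  moreover have "row_vector a b 1 0 * word_value a b w = row_vector a b 1 0"
    by (simp add: row_vector_word_value[OF assms(1,2)] A)
      (simp add: row_vector_def scalar_mat_def mat2_defs poly_value_add poly_value_mult assms(4))
  ultimately show ?thesis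
    by (simp add: column_vector_def row_vector_def algebra_simps)
qed

text \<open>
  The columns \<open>(f, g)\<close> of \<open>M(w) - 1\<close> are coordinates of \<open>0\<close>, that is, \<open>x f(x) + b g(x) = 0\<close>.
  Multiplication by \<open>a\<close> leaves \<open>x g(x) = 0\<close>, multiplication by \<open>x\<close> leaves \<open>x\<^sup>2 f(x) = 0\<close>.
\<close>

lemma word_value_eq_1_annihilator:
  assumes "a * a = 0" "b * b = 0" "word_value a b w = 1"
    and "q \<in> {e11 (generic_word_mat w) - 1, e12 (generic_word_mat w),
              e21 (generic_word_mat w), e22 (generic_word_mat w) - 1}"
  shows "poly_value ([:0, 0, 1:] * q) (a * b) = 0"
proof -
  let ?M = "generic_word_mat w" and ?x = "a * b"
  have *: "?x * (?x * poly_value f ?x) = 0 \<and> ?x * (?x * poly_value g ?x) = 0"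
    if "column_vector a b f g = 0" for f g
  proof -
    have ab: "a * column_vector a b f g = ?x * poly_value g ?x"
      using assms(1) by (simp add: column_vector_def distrib_left flip: mult.assoc)
    have "?x * b = 0"
      using assms(2) by (simp add: mult.assoc)
    then have "?x * column_vector a b f g = ?x * (?x * poly_value f ?x)"
      by (simp add: column_vector_def distrib_left flip: mult.assoc)
    with ab that show ?thesis
      by simp
  qed
  have "column_vector a b (f - f') (g - g') = column_vector a b f g - column_vector a b f' g'"
    for f f' g g'
    by (simp add: column_vector_def poly_value_diff algebra_simps)
  from this[of "e11 ?M" 1 "e21 ?M" 0] this[of "e12 ?M" 0 "e22 ?M" 1]
  have "column_vector a b (e11 ?M - 1) (e21 ?M) = 0" "column_vector a b (e12 ?M) (e22 ?M - 1) = 0"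
    using word_value_column_vector[OF assms(1,2), of w 1 0]
      word_value_column_vector[OF assms(1,2), of w 0 1] assms(3)
    by simp_all
  from *[OF this(1)] *[OF this(2)] show ?thesis
    using assms(4) by (auto simp: poly_value_mult mult.assoc)
qed

text \<open>
  Transcendence over \<open>\<rat>\<close> only rules out annihilating polynomials with rational coefficients, so
  the entries have to be known to be of this kind.
\<close>

lemma rational_coeffs_generic_word_mat:
  "coeff (e11 (generic_word_mat w)) i \<in> \<rat> \<and> coeff (e12 (generic_word_mat w)) i \<in> \<rat> \<and>
   coeff (e21 (generic_word_mat w)) i \<in> \<rat> \<and> coeff (e22 (generic_word_mat w)) i \<in> \<rat>"
proof (induction w arbitrary: i)
  case Nil
  show ?case
    by (cases "i = 0") (simp_all add: one_mat2_def)
next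
  case (Cons x w)
  obtain s e where "x = (s, e)"
    by (cases x)
  then show ?case
    using Cons.IH Cons.IH[of "i - 1"]
    by (cases s; cases e) (auto simp: Let_def mat2_defs coeff_pCons' intro: Rats_add Rats_diff)
qed

text \<open>
  The rational polynomial is replaced by a complex one with rational coefficients, so that only
  one notion of substitution is needed.
\<close>

lemma algebraic_over_rat_iff:
  "algebraic_over_rat x \<longleftrightarrow>
     (\<exists>p. p \<noteq> 0 \<and> (\<forall>i. coeff p i \<in> \<rat>) \<and> poly_value p (to_tensor x) = 0)"
proof
  assume "algebraic_over_rat x"
  then obtain p :: "rat poly" where p: "p \<noteq> 0"
    "(\<Sum>i\<le>degree p. cscale (of_rat (coeff p i)) (to_tensor x ^ i)) = 0"
    by (auto simp: algebraic_over_rat_def)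
  then have "map_poly of_rat p \<noteq> (0 :: complex poly)"
    "poly_value (map_poly of_rat p) (to_tensor x) = 0"
    by (simp_all add: poly_value_def coeff_map_poly degree_map_poly map_poly_eq_0_iff)
  then show "\<exists>p. p \<noteq> 0 \<and> (\<forall>i. coeff p i \<in> \<rat>) \<and> poly_value p (to_tensor x) = 0"
    by (intro exI[of _ "map_poly of_rat p"]) (simp add: coeff_map_poly)
next
  assume "\<exists>p. p \<noteq> 0 \<and> (\<forall>i. coeff p i \<in> \<rat>) \<and> poly_value p (to_tensor x) = 0"
  then obtain p where p: "p \<noteq> 0" "\<forall>i. coeff p i \<in> \<rat>" "poly_value p (to_tensor x) = 0"
    by blast
  define q :: "rat poly" where "q = map_poly (inv_into UNIV of_rat) p"
  have inv_0: "inv_into UNIV (of_rat :: rat \<Rightarrow> complex) 0 = 0"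
    using inv_f_f[of "of_rat :: rat \<Rightarrow> complex" 0] by (simp add: inj_def)
  have q: "of_rat (coeff q i) = coeff p i" for i
  proof -
    have "coeff p i \<in> range of_rat"
      using p(2) by (simp add: Rats_def)
    from f_inv_into_f[OF this] show ?thesis
      by (simp add: q_def coeff_map_poly inv_0)
  qed
  then have "coeff q i = 0 \<longleftrightarrow> coeff p i = 0" for i
    by (metis of_rat_eq_0_iff)
  then have "degree q = degree p"
    by (simp add: degree_def)
  then have "(\<Sum>i\<le>degree q. cscale (of_rat (coeff q i)) (to_tensor x ^ i)) = 0"
    using p(3) by (simp add: poly_value_def q)
  moreover have "q \<noteq> 0"
    using p(1) q by (metis coeff_0 of_rat_0 poly_eqI)
  ultimately show "algebraic_over_rat x"
    unfolding algebraic_over_rat_def by blast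
qed


section \<open>A torsion-free ring embeds into its complex algebra\<close>

lemma ex_rational_functional:
  "\<exists>f :: complex \<Rightarrow> rat. f 1 = 1 \<and> (\<forall>x y. f (x + y) = f x + f y)"
proof -
  interpret vector_space_pair "\<lambda>q z. of_rat q * z :: complex" "(*) :: rat \<Rightarrow> rat \<Rightarrow> rat"
    by unfold_locales (simp_all add: algebra_simps of_rat_add of_rat_mult)
  have "vs1.independent {1}"
    by simp
  from linear_independent_extend[OF this, of "\<lambda>_. 1"] obtain f
    where f: "Vector_Spaces.linear (\<lambda>q z. of_rat q * z :: complex) (*) f" "f 1 = 1"
    by auto
  from f(1) have "f (x + y) = f x + f y" for x y
    by (rule linear_add)
  then show ?thesis
    using f(2) by (intro exI[of _ f]) simp
qed

lemma rat_times_fact_Ints: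
  assumes "snd (quotient_of q) \<le> int k"
  shows "of_nat (fact k) * q \<in> \<int>"
proof -
  obtain m n where mn: "quotient_of q = (m, n)"
    by (cases "quotient_of q")
  then have "n > 0"
    by (rule quotient_of_denom_pos)
  then obtain n' where n': "n = int n'" "n' > 0"
    using zero_less_imp_eq_int by blast
  have "n' dvd fact k"
    using assms mn n' by (intro dvd_fact) auto
  then obtain d where "fact k = n' * d" ..
  then have "of_nat (fact k) * q = of_int (int d * m)"
    using quotient_of_div[OF mn] n' by (simp only: of_nat_mult of_int_mult) (simp add: field_simps)
  then show ?thesis
    by simp
qed

text \<open>
  Let \<open>f : \<complex> \<rightarrow> \<rat>\<close> be additive with \<open>f 1 = 1\<close>. The map \<open>r \<otimes> z \<mapsto> f(z) r\<close> would separate \<open>r \<otimes> 1\<close>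
  from \<open>0\<close>, but its values have denominators. Multiplication by \<open>d k = k!\<close> removes the
  denominator of any given rational number once \<open>k\<close> is large, and so the sum \<open>S k\<close> of the
  elements \<open>\<lfloor>k! f(z)\<rfloor> r\<close> is, for almost all \<open>k\<close>, the same for two equivalent formal sums. It
  maps \<open>r \<otimes> 1\<close> to \<open>k! r\<close>.
\<close>

lemma to_tensor_eq_0_iff:
  fixes r :: "'a::ring_1"
  assumes torsion_free: "\<And>(n::nat) (x::'a). of_nat n * x = 0 \<Longrightarrow> n = 0 \<or> x = 0"
  shows "to_tensor r = 0 \<longleftrightarrow> r = 0"
proof
  obtain f :: "complex \<Rightarrow> rat" where f: "f 1 = 1" "\<And>x y. f (x + y) = f x + f y"
    using ex_rational_functional by blast
  define d :: "nat \<Rightarrow> nat" where "d = fact"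
  define S :: "nat \<Rightarrow> ('a \<times> complex) multiset \<Rightarrow> 'a" where
    "S k M = (\<Sum>p\<in>#M. of_int \<lfloor>of_nat (d k) * f (snd p)\<rfloor> * fst p)" for k M
  have Ints: "eventually (\<lambda>k. of_nat (d k) * f z \<in> \<int>) sequentially" for z
    using eventually_ge_at_top[of "nat (snd (quotient_of (f z)))"]
    by eventually_elim (unfold d_def, rule rat_times_fact_Ints, linarith)
  have S: "eventually (\<lambda>k. S k M = S k N) sequentially" if "tensor_eq M N" for M N
    using that
  proof induction
    case (te_trans M N P)
    from te_trans.IH show ?case
      by eventually_elim simp
  next
    case (te_add M M' N N')
    from te_add.IH show ?case
      by eventually_elim (simp add: S_def)
  next
    case (te_right r z w)
    from Ints[of z] show ?case
    proof eventually_elim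
      case (elim k)
      then obtain m where m: "of_nat (d k) * f z = of_int m"
        by (elim Ints_cases)
      then have "\<lfloor>of_nat (d k) * f (z + w)\<rfloor> = m + \<lfloor>of_nat (d k) * f w\<rfloor>"
        by (simp only: f distrib_left m int_add_floor)
      then show ?case
        by (simp add: S_def m distrib_right)
    qed
  qed (auto simp: S_def distrib_left eq_commute)
  assume "to_tensor r = 0"
  then have "tensor_eq {#(r, 1)#} {#}"
    by (simp add: to_tensor_def pure_tensor.abs_eq zero_complex_tensor.abs_eq
        complex_tensor.abs_eq_iff)
  from S[OF this] obtain k where "S k {#(r, 1)#} = S k {#}"
    by (auto simp: eventually_sequentially)
  then have "of_nat (d k) * r = 0"
    by (simp add: S_def f)
  moreover have "d k \<noteq> 0"
    by (simp add: d_def)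
  ultimately show "r = 0"
    using torsion_free[of "d k" r] by auto
next
  assume "r = 0"
  then show "to_tensor r = 0"
    using pure_tensor_add_left[of 0 0 1] by (simp add: to_tensor_def)
qed

lemma to_tensor_1: "to_tensor 1 = 1"
  and to_tensor_add: "to_tensor (r + s) = to_tensor r + to_tensor s"
  and to_tensor_mult: "to_tensor (r * s) = to_tensor r * to_tensor s"
  by (simp_all add: to_tensor_def pure_tensor_one pure_tensor_add_left pure_tensor_mult)


section \<open>Free pairs of unipotent elements\<close>

text \<open>
  If \<open>p = (t - z) q\<close>, then \<open>q(x)\<close> is nonzero by minimality, and it is an eigenvector for \<open>z\<close>.
\<close>

lemma eigenvalue_of_root_of_minimal:
  assumes "p \<noteq> 0" "poly_value p (to_tensor x) = 0"
    and min: "\<And>q. q \<noteq> 0 \<Longrightarrow> poly_value q (to_tensor x) = 0 \<Longrightarrow> degree p \<le> degree q"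
    and z: "poly p z = 0"
  shows "z \<in> eigenvalues x"
proof -
  obtain q where q: "p = [:- z, 1:] * q"
    using z by (metis dvdE poly_eq_0_iff_dvd)
  then have "q \<noteq> 0"
    using assms(1) by auto
  then have "degree p = Suc (degree q)"
    unfolding q by (subst degree_mult_eq) auto
  then have "poly_value q (to_tensor x) \<noteq> 0"
    using min[OF \<open>q \<noteq> 0\<close>] by auto
  moreover have "to_tensor x * poly_value q (to_tensor x) = cscale z (poly_value q (to_tensor x))"
  proof -
    have "[:0, 1:] * q = p + smult z q"
      by (simp add: q algebra_simps)
    then have "poly_value ([:0, 1:] * q) (to_tensor x) = poly_value (p + smult z q) (to_tensor x)"
      by simp
    then show ?thesis
      using assms(2) by (simp add: poly_value_add poly_value_smult poly_value_mult)
  qed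
  ultimately show ?thesis
    unfolding eigenvalues_def by blast
qed

theorem theorem1p1:
  fixes a b :: "'a::ring_char_0"
  assumes torsion_free: "\<And>(n::nat) (x::'a). of_nat n * x = 0 \<Longrightarrow> n = 0 \<or> x = 0"
    and "a ^ 2 = 0" and "b ^ 2 = 0"
  shows "free_pair unit_group (1 + a) (1 + b) \<longleftrightarrow>
           transcendental_over_rat (a * b) \<or>
           (algebraic_over_rat (a * b) \<and> (\<exists>z \<in> eigenvalues (a * b). free_complex z))"
proof -
  have sq: "a * a = 0" "b * b = 0"
    using assms(2,3) by (simp_all add: power2_eq_square)
  define \<alpha> \<beta> where "\<alpha> = to_tensor a" and "\<beta> = to_tensor b"
  have \<alpha>\<beta>: "to_tensor (a * b) = \<alpha> * \<beta>"
    by (simp add: \<alpha>_def \<beta>_def to_tensor_mult)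
  note to_tensor_0 = to_tensor_eq_0_iff[OF torsion_free]
  have sq': "\<alpha> * \<alpha> = 0" "\<beta> * \<beta> = 0"
    by (simp_all add: \<alpha>_def \<beta>_def to_tensor_0 sq flip: to_tensor_mult)
  have "word_value a b w = 1 \<longleftrightarrow> word_value \<alpha> \<beta> w = 1" for w
  proof -
    have "word_value \<alpha> \<beta> w = to_tensor (word_value a b w)"
      unfolding \<alpha>_def \<beta>_def
      by (rule word_value_hom[symmetric]) (simp_all add: to_tensor_1 to_tensor_add to_tensor_mult)
    moreover have "to_tensor r = 1 \<longleftrightarrow> r = 1" for r :: 'a
      using to_tensor_0[of "r - 1"] to_tensor_add[of "r - 1" 1] by (auto simp: to_tensor_1)
    ultimately show ?thesis
      by simp
  qed
  then have free_iff: "free_pair unit_group (1 + a) (1 + b) \<longleftrightarrow>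
      (\<forall>w. word_value \<alpha> \<beta> w = 1 \<longrightarrow> trivial_word w)"
    by (simp add: free_pair_units_iff[OF sq])
  show ?thesis
  proof
    assume free: "free_pair unit_group (1 + a) (1 + b)"
    have "\<exists>z \<in> eigenvalues (a * b). free_complex z" if alg: "algebraic_over_rat (a * b)"
    proof (rule ccontr)
      assume non_free: "\<not> ?thesis"
      let ?A = "\<lambda>p. p \<noteq> 0 \<and> poly_value p (\<alpha> * \<beta>) = 0"
      obtain p\<^sub>0 where "p\<^sub>0 \<noteq> 0" "poly_value p\<^sub>0 (to_tensor (a * b)) = 0"
        using alg by (auto simp: algebraic_over_rat_iff)
      then have "?A p\<^sub>0"
        by (simp add: \<alpha>\<beta>)
      from ex_has_least_nat[of ?A, OF this, of degree]
      obtain p where p: "?A p" "\<And>q. ?A q \<Longrightarrow> degree p \<le> degree q"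
        by blast
      have "\<not> free_complex z" if "poly p z = 0" for z
        using eigenvalue_of_root_of_minimal[of p "a * b" z] p that non_free by (auto simp: \<alpha>\<beta>)
      then obtain v where v: "\<not> trivial_word v" "congruent_one p (generic_word_mat v)"
        using ex_word_congruent_one p(1) by blast
      let ?u = "[(False, True)] :: bool letter list"
      obtain w where w: "\<not> trivial_word (commutator_word ?u (w @ v @ inv_word w))"
        using ex_noncommuting_conjugate[OF not_trivial_letter v(1)] by blast
      have "congruent_one p (generic_word_mat (w @ v @ inv_word w))"
        using congruent_one_conjugate[OF v(2) word_mat_inv_word'] by (simp add: mult.assoc)
      from congruent_one_imp_centralises[OF sq' this]
      have "word_value \<alpha> \<beta> (commutator_word ?u (w @ v @ inv_word w)) = 1"
        using p(1) by (subst word_value_commutator_eq_1_iff[OF sq']) (simp add: mult.assoc)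
      then show False
        using free w unfolding free_iff by blast
    qed
    then show "transcendental_over_rat (a * b) \<or>
        (algebraic_over_rat (a * b) \<and> (\<exists>z \<in> eigenvalues (a * b). free_complex z))"
      by (auto simp: transcendental_over_rat_def)
  next
    assume *: "transcendental_over_rat (a * b) \<or>
        (algebraic_over_rat (a * b) \<and> (\<exists>z \<in> eigenvalues (a * b). free_complex z))"
    show "free_pair unit_group (1 + a) (1 + b)"
      unfolding free_iff
    proof (intro allI impI)
      fix w assume w: "word_value \<alpha> \<beta> w = 1"
      let ?M = "generic_word_mat w"
      let ?E = "{e11 ?M - 1, e12 ?M, e21 ?M, e22 ?M - 1}"
      have ann: "poly_value ([:0, 0, 1:] * q) (\<alpha> * \<beta>) = 0" if "q \<in> ?E" for q
        using word_value_eq_1_annihilator[OF sq' w that] .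
      have trivial: "trivial_word w" if "free_complex z" "\<And>q. q \<in> ?E \<Longrightarrow> poly q z = 0" for z
      proof -
        have "word_mat z w = 1"
          using that(2)[of "e11 ?M - 1"] that(2)[of "e12 ?M"] that(2)[of "e21 ?M"]
            that(2)[of "e22 ?M - 1"]
          by (intro mat2.expand) (simp add: one_mat2_def flip: poly_generic_word_mat)
        then show ?thesis
          using that(1) by (simp add: free_complex_iff)
      qed
      from * show "trivial_word w"
      proof
        assume trans: "transcendental_over_rat (a * b)"
        have zero: "q = 0" if "q \<in> ?E" for q
        proof -
          have "coeff q i \<in> \<rat>" for i
            using that rational_coeffs_generic_word_mat[of w i]
            by (auto intro!: Rats_diff)
          then have "\<forall>i. coeff ([:0, 0, 1:] * q) i \<in> \<rat>"
            by (simp add: coeff_pCons')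
          then have "[:0, 0, 1:] * q = 0"
            using trans ann[OF that] unfolding transcendental_over_rat_def algebraic_over_rat_iff \<alpha>\<beta>
            by blast
          then show "q = 0"
            by simp
        qed
        have "free_complex 9"
          using word_mat_9_not_scalar[of _ 1] by (auto simp: free_complex_iff scalar_mat_1)
        from trivial[OF this] show "trivial_word w"
          using zero poly_0 by metis
      next
        assume "algebraic_over_rat (a * b) \<and> (\<exists>z\<in>eigenvalues (a * b). free_complex z)"
        then obtain z t where z: "free_complex z" and t: "t \<noteq> 0" "\<alpha> * \<beta> * t = cscale z t"
          by (auto simp: eigenvalues_def \<alpha>\<beta>)
        \<comment> \<open>At \<open>z = 0\<close> the second generator is the identity matrix.\<close>
        have "z \<noteq> 0"
        proof
          assume "z = 0"
          then have "word_mat z [(False, True)] = 1"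
            by (simp add: mat2_defs)
          then show False
            using z not_trivial_letter unfolding free_complex_iff by blast
        qed
        have "poly q z = 0" if "q \<in> ?E" for q
        proof -
          have "cscale (poly ([:0, 0, 1:] * q) z) t = 0"
            using poly_value_eigenvector[OF t(2)] ann[OF that] by (metis mult_zero_left)
          then show ?thesis
            using t(1) \<open>z \<noteq> 0\<close> by (simp add: cscale_eq_0_iff)
        qed
        then show "trivial_word w"
          using trivial[OF z] by blast
      qed
    qed
  qed
qed

end
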